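(* Let $q=p^e$ be a prime power ($p$ prime, $e\ge1$). Then the group $F(S[t,t^{-1}])$, with $S=S(q)=\mathcal{R}/\mathcal{I}(q)\Sigma$, is solvable, and its derived length is at most $k$ whenever $k$ is a positive integer with $2^{k-1}\ge e(p^e-p^{e-1})+1$.
   Context: $\mathcal{R}=\mathbb{Z}[x,x^{-1},y,y^{-1}]$; positive units of $\mathcal{R}$ are the monomials $x^iy^j$. $\Sigma$ is the augmentation ideal of $\mathcal{R}$ (kernel of $x,y\mapsto1$ to $\mathbb{Z}$). $\mathcal{I}(q)$ is the ideal of $\mathcal{R}$ generated by all $1+u+\dots+u^{q-1}$, $u$ a positive unit. Let $M_1=\begin{pmatrix}1&1-y\\0&x\end{pmatrix}$ and $M_2T=\begin{pmatrix}yt&0\\1-xt&1\end{pmatrix}$ (matrices over $\mathcal{R}[t,t^{-1}]$). $F(S[t,t^{-1}])$ is the subgroup of $GL_2(S[t,t^{-1}])$ generated by the images of $M_1$ and $M_2T$ under entrywise reduction of coefficients from $\mathcal{R}$ to $S$ (with $t$ unchanged). Derived length $\le k$ means the $k$-th derived subgroup is trivial. *)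

theory Defs
  imports "HOL-Library.Poly_Mapping" "HOL-Library.Product_Plus" "HOL-Algebra.Solvable_Groups"
    "HOL-Computational_Algebra.Primes"
begin

(* R = Z[x,x^-1,y,y^-1] as the group ring Z[Z^2]: finitely supported int-valued
   functions on exponent pairs (i,j) <-> x^i y^j, multiplication = convolution. *)
type_synonym Rg = "(int \<times> int) \<Rightarrow>\<^sub>0 int"

(* R[t,t^-1] as finitely supported functions Z -> R (n <-> coefficient of t^n). *)
type_synonym Rt = "int \<Rightarrow>\<^sub>0 Rg"

definition mono :: "int \<Rightarrow> int \<Rightarrow> Rg" where
  "mono i j = Poly_Mapping.single (i, j) 1"

definition xR :: Rg where "xR = mono 1 0"
definition yR :: Rg where "yR = mono 0 1"

inductive_set ideal_gen :: "'a::comm_ring_1 set \<Rightarrow> 'a set" for G where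
  zero: "0 \<in> ideal_gen G"
| gen: "g \<in> G \<Longrightarrow> r * g \<in> ideal_gen G"
| add: "a \<in> ideal_gen G \<Longrightarrow> b \<in> ideal_gen G \<Longrightarrow> a + b \<in> ideal_gen G"

definition augmentation :: "Rg \<Rightarrow> int" where
  "augmentation f = (\<Sum>k\<in>Poly_Mapping.keys f. Poly_Mapping.lookup f k)"

definition Sigma_ideal :: "Rg set" where
  "Sigma_ideal = {f. augmentation f = 0}"

(* I(q): generated by 1 + u + ... + u^(q-1), u a positive unit x^i y^j *)
definition Iq :: "nat \<Rightarrow> Rg set" where
  "Iq q = ideal_gen {(\<Sum>l<q. (mono i j) ^ l) | i j. True}"

definition Jq :: "nat \<Rightarrow> Rg set" where
  "Jq q = ideal_gen {a * b | a b. a \<in> Iq q \<and> b \<in> Sigma_ideal}"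

definition cR :: "Rg \<Rightarrow> Rt" where "cR a = Poly_Mapping.single 0 a"
definition tT :: Rt where "tT = Poly_Mapping.single 1 1"

datatype 'a mat2 = M2 'a 'a 'a 'a   (* M2 a b c d = [[a,b],[c,d]] *)

fun mmul :: "'a::comm_ring_1 mat2 \<Rightarrow> 'a mat2 \<Rightarrow> 'a mat2" where
  "mmul (M2 a b c d) (M2 a' b' c' d') =
     M2 (a*a' + b*c') (a*b' + b*d') (c*a' + d*c') (c*b' + d*d')"

definition mone :: "'a::comm_ring_1 mat2" where "mone = M2 1 0 0 1"

definition M1 :: "Rt mat2" where
  "M1 = M2 1 (cR (1 - yR)) 0 (cR xR)"

definition M2T :: "Rt mat2" where
  "M2T = M2 (cR yR * tT) 0 (1 - cR xR * tT) 1"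

inductive_set Gen :: "Rt mat2 set" where
  g1: "M1 \<in> Gen"
| g2: "M2T \<in> Gen"
| one: "mone \<in> Gen"
| mul: "A \<in> Gen \<Longrightarrow> B \<in> Gen \<Longrightarrow> mmul A B \<in> Gen"
| inv: "A \<in> Gen \<Longrightarrow> mmul A B = mone \<Longrightarrow> mmul B A = mone \<Longrightarrow> B \<in> Gen"

(* reduction R[t,t^-1] -> S[t,t^-1], S = R / I(q)Sigma: coefficientwise modulo Jq q *)
definition congS :: "nat \<Rightarrow> Rt \<Rightarrow> Rt \<Rightarrow> bool" where
  "congS q f g \<longleftrightarrow> (\<forall>n. Poly_Mapping.lookup f n - Poly_Mapping.lookup g n \<in> Jq q)"

fun mcong :: "nat \<Rightarrow> Rt mat2 \<Rightarrow> Rt mat2 \<Rightarrow> bool" where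
  "mcong q (M2 a b c d) (M2 a' b' c' d') \<longleftrightarrow>
     congS q a a' \<and> congS q b b' \<and> congS q c c' \<and> congS q d d'"

(* image of a matrix in M_2(S[t,t^-1]), represented as its congruence class *)
definition mcls :: "nat \<Rightarrow> Rt mat2 \<Rightarrow> Rt mat2 set" where
  "mcls q A = {B. mcong q A B}"

definition FS :: "nat \<Rightarrow> Rt mat2 set monoid" where
  "FS q = \<lparr> carrier = mcls q ` Gen,
            monoid.mult = (\<lambda>X Y. mcls q (mmul (SOME A. A \<in> X) (SOME B. B \<in> Y))),
            monoid.one = mcls q mone \<rparr>"

end

theory Submission
  imports Defs Complex_Main
begin

text \<open>
  Let \<open>\<Gamma>(n)\<close> be the subgroup of those elements of \<open>F\<close> that are congruent to \<open>1\<close> modulo \<open>\<Sigma>^n\<close>. Modulo \<open>\<Sigma>\<close> the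
  group is abelian, and \<open>[A, B] - 1 = ((A - 1)(B - 1) - (B - 1)(A - 1)) (BA)^-1\<close>, so the \<open>k\<close>-th derived
  subgroup lies in \<open>\<Gamma>(2^(k-1))\<close>. It remains to see that \<open>\<Sigma>^N\<close> is contained in \<open>I(q)\<close> for
  \<open>N = e(p^e - p^(e-1))\<close>, because then \<open>\<Sigma>^(N+1)\<close> is contained in \<open>I(q)\<Sigma>\<close>.

  Since \<open>x^q - 1\<close> and \<open>y^q - 1\<close> lie in \<open>I(q)\<close>, this is a question about the group ring of \<open>A = (Z/q)^2\<close>, and an
  element of \<open>Z[A]\<close> that vanishes at all nontrivial characters is an integral multiple of
  \<open>(1 + ... + x^(q-1)) (1 + ... + y^(q-1))\<close>, which lies in \<open>I(q)\<close>. Hence it suffices to find, for \<open>m + n = N\<close>,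
  an element of \<open>I(q)\<close> with the same values as \<open>(x - 1)^m (y - 1)^n\<close> at all nontrivial characters. In
  \<open>Z[\<zeta>]\<close>, with \<open>\<zeta>\<close> of order \<open>p^j\<close>, the prime \<open>p\<close> divides \<open>(\<zeta> - 1)^(p^j - p^(j-1))\<close>, so \<open>(\<zeta> - 1)^N\<close> is
  \<open>p^(2e-j)\<close> times an integral polynomial in \<open>\<zeta>\<close>. These quotients are the coefficients of an explicit
  combination of the norm elements \<open>1 + u + ... + u^(q-1)\<close> that does the job.
\<close>

section \<open>Ideals\<close>

lemma ideal_gen_mult: "a \<in> ideal_gen G \<Longrightarrow> r * a \<in> ideal_gen G"
proof (induction rule: ideal_gen.induct)
  case (gen g s)
  then show ?case
    using ideal_gen.gen[of g G "r * s"] by (simp add: mult.assoc)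
qed (auto simp: distrib_left intro: ideal_gen.intros)

lemma ideal_gen_base: "g \<in> G \<Longrightarrow> g \<in> ideal_gen G"
  using ideal_gen.gen[of g G 1] by simp

lemma ideal_gen_subset:
  assumes "\<And>g. g \<in> G \<Longrightarrow> g \<in> ideal_gen H" "a \<in> ideal_gen G"
  shows "a \<in> ideal_gen H"
  using assms(2) by induction (auto intro: ideal_gen.intros ideal_gen_mult assms(1))

definition is_ideal :: "'a::comm_ring_1 set \<Rightarrow> bool" where
  "is_ideal J \<longleftrightarrow> 0 \<in> J \<and> (\<forall>a\<in>J. \<forall>b\<in>J. a + b \<in> J) \<and> (\<forall>a\<in>J. \<forall>r. r * a \<in> J)"

lemma is_idealD:
  assumes "is_ideal J"
  shows "0 \<in> J" "a \<in> J \<Longrightarrow> b \<in> J \<Longrightarrow> a + b \<in> J" "a \<in> J \<Longrightarrow> r * a \<in> J" "a \<in> J \<Longrightarrow> a * r \<in> J"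
    "a \<in> J \<Longrightarrow> - a \<in> J" "a \<in> J \<Longrightarrow> b \<in> J \<Longrightarrow> a - b \<in> J"
proof -
  show zero: "0 \<in> J" and add: "\<And>a b. a \<in> J \<Longrightarrow> b \<in> J \<Longrightarrow> a + b \<in> J"
    and mult: "\<And>a r. a \<in> J \<Longrightarrow> r * a \<in> J"
    using assms by (auto simp: is_ideal_def)
  show "a \<in> J \<Longrightarrow> a * r \<in> J"
    using mult by (simp add: mult.commute)
  show uminus: "\<And>a. a \<in> J \<Longrightarrow> - a \<in> J"
    using mult[of _ "- 1"] by simp
  show "a \<in> J \<Longrightarrow> b \<in> J \<Longrightarrow> a - b \<in> J"
    using add[of a "- b"] uminus[of b] by simp
qed

lemma is_ideal_sum:
  assumes "is_ideal J" "\<And>i. i \<in> A \<Longrightarrow> f i \<in> J"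
  shows "(\<Sum>i\<in>A. f i) \<in> J"
  using assms(2) by (induction A rule: infinite_finite_induct) (auto intro: is_idealD[OF assms(1)])

lemma is_ideal_ideal_gen: "is_ideal (ideal_gen G)"
  by (auto simp: is_ideal_def intro: ideal_gen.intros ideal_gen_mult)

text \<open>Each coefficient of \<open>r * f\<close> is a finite sum of multiples of coefficients of
  \<open>f\<close>. This turns the coefficientwise \<open>congS\<close> into congruence modulo an
  ideal.\<close>

lemma is_ideal_coefficients:
  fixes J :: "'b::comm_ring_1 set"
  assumes "is_ideal J"
  shows "is_ideal {f :: 'a::comm_monoid_add \<Rightarrow>\<^sub>0 'b. \<forall>n. Poly_Mapping.lookup f n \<in> J}"
proof -
  have "Poly_Mapping.lookup (r * f) n \<in> J" if "\<forall>n. Poly_Mapping.lookup f n \<in> J"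
    for r f :: "'a \<Rightarrow>\<^sub>0 'b" and n
  proof -
    have "(Poly_Mapping.lookup f b when n = a + b) \<in> J" for a b
      using that is_idealD(1)[OF assms] by (simp add: when_def)
    then show ?thesis
      unfolding lookup_mult Sum_any.expand_set
      by (intro is_ideal_sum[OF assms] is_idealD(3)[OF assms])
  qed
  then show ?thesis
    unfolding is_ideal_def by (auto simp: lookup_add intro: is_idealD[OF assms])
qed

section \<open>Characters of the group ring\<close>

lemma mono_mult: "mono i j * mono k l = mono (i + k) (j + l)"
  by (simp add: mono_def mult_single)

lemma mono_0_0: "mono 0 0 = 1"
  by (simp add: mono_def flip: zero_prod_def single_one)

lemma mono_power: "mono i j ^ n = mono (int n * i) (int n * j)"
  by (induction n) (simp_all add: mono_0_0 mono_mult algebra_simps)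

lemma xR_power: "xR ^ n = mono (int n) 0" and yR_power: "yR ^ n = mono 0 (int n)"
  by (simp_all add: xR_def yR_def mono_power)

text \<open>\<open>Rg\<close> is the free abelian group on the exponent pairs, so monomials and
  differences reach every element.\<close>

lemma Rg_induct:
  assumes "P 0" "\<And>i j. P (mono i j)" "\<And>f g. P f \<Longrightarrow> P g \<Longrightarrow> P (f - g)"
  shows "P f"
proof (rule frag_induction[of f UNIV])
  show "P (frag_of x)" for x
    using assms(2)[of "fst x" "snd x"] by (simp add: mono_def)
qed (use assms in auto)

text \<open>Substitution of \<open>w\<close> and \<open>z\<close> for x and y, a ring homomorphism
  for nonzero arguments. At pairs of \<open>q\<close>-th roots of unity these are the characters of
  (Z/q)^2.\<close>

definition ev :: "complex \<Rightarrow> complex \<Rightarrow> Rg \<Rightarrow> complex" where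
  "ev w z f = (\<Sum>k\<in>Poly_Mapping.keys f.
     of_int (Poly_Mapping.lookup f k) * (w powi fst k * z powi snd k))"

lemma ev_superset:
  assumes "finite S" "Poly_Mapping.keys f \<subseteq> S"
  shows "ev w z f = (\<Sum>k\<in>S. of_int (Poly_Mapping.lookup f k) * (w powi fst k * z powi snd k))"
  unfolding ev_def using assms by (intro sum.mono_neutral_left) (auto simp: in_keys_iff)

lemma ev_0 [simp]: "ev w z 0 = 0"
  by (simp add: ev_def)

lemma ev_diff [simp]: "ev w z (f - g) = ev w z f - ev w z g"
proof -
  let ?S = "Poly_Mapping.keys f \<union> Poly_Mapping.keys g"
  have "Poly_Mapping.keys (f - g) \<subseteq> ?S"
    by (rule keys_diff)
  then show ?thesis
    by (simp add: ev_superset[of ?S] lookup_minus algebra_simps sum_subtractf)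
qed

lemma ev_mono: "ev w z (mono i j) = w powi i * z powi j"
  by (simp add: ev_def mono_def)

lemma ev_uminus [simp]: "ev w z (- f) = - ev w z f"
  using ev_diff[of w z 0 f] by simp

lemma ev_add [simp]: "ev w z (f + g) = ev w z f + ev w z g"
  using ev_diff[of w z f "- g"] by simp

lemma ev_sum [simp]: "ev w z (\<Sum>i\<in>A. f i) = (\<Sum>i\<in>A. ev w z (f i))"
  by (induction A rule: infinite_finite_induct) auto

lemma ev_1 [simp]: "ev w z 1 = 1"
  by (simp add: ev_mono flip: mono_0_0)

lemma ev_mult [simp]:
  assumes "w \<noteq> 0" "z \<noteq> 0"
  shows "ev w z (f * g) = ev w z f * ev w z g"
proof (induction f rule: Rg_induct)
  case (2 i j)
  show ?case
  proof (induction g rule: Rg_induct)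
    case (2 k l)
    show ?case
      using assms by (simp add: mono_mult ev_mono power_int_add)
  qed (simp_all add: algebra_simps)
qed (simp_all add: algebra_simps)

lemma ev_power [simp]: "w \<noteq> 0 \<Longrightarrow> z \<noteq> 0 \<Longrightarrow> ev w z (f ^ n) = ev w z f ^ n"
  by (induction n) simp_all

lemma ev_of_nat [simp]: "ev w z (of_nat n) = of_nat n"
  by (induction n) simp_all

lemma ev_of_int [simp]: "ev w z (of_int n) = of_int n"
  by (cases n rule: int_cases2) simp_all

lemma ev_xR [simp]: "ev w z xR = w" and ev_yR [simp]: "ev w z yR = z"
  by (simp_all add: xR_def yR_def ev_mono)

section \<open>Membership in I(q) and passage to the group ring of (Z/q)^2\<close>

lemma power_diff_1_geometric: "(u - 1) * (\<Sum>l<n. u ^ l) = u ^ n - (1 :: 'a :: comm_ring_1)"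
  by (simp add: power_diff_1_eq)

lemma geometric_in_Iq: "(\<Sum>l<q. (mono i j) ^ l) \<in> Iq q"
  unfolding Iq_def by (rule ideal_gen_base) blast

lemma xR_geometric_in_Iq: "(\<Sum>l<q. xR ^ l) \<in> Iq q"
  unfolding xR_def by (rule geometric_in_Iq)

lemma yR_geometric_in_Iq: "(\<Sum>l<q. yR ^ l) \<in> Iq q"
  unfolding yR_def by (rule geometric_in_Iq)

lemma Iq_mult: "a \<in> Iq q \<Longrightarrow> r * a \<in> Iq q"
  unfolding Iq_def by (rule ideal_gen_mult)

lemma Iq_add: "a \<in> Iq q \<Longrightarrow> b \<in> Iq q \<Longrightarrow> a + b \<in> Iq q"
  unfolding Iq_def by (rule ideal_gen.add)

lemma Iq_sum: "(\<And>i. i \<in> A \<Longrightarrow> f i \<in> Iq q) \<Longrightarrow> (\<Sum>i\<in>A. f i) \<in> Iq q"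
  unfolding Iq_def by (intro is_ideal_sum is_ideal_ideal_gen)

lemma power_minus_1_in_Iq: "xR ^ q - 1 \<in> Iq q" "yR ^ q - 1 \<in> Iq q"
  unfolding power_diff_1_geometric[symmetric]
  by (intro Iq_mult xR_geometric_in_Iq yR_geometric_in_Iq)+

text \<open>Shifting an exponent by \<open>q\<close> adds a multiple of \<open>xR ^ q - 1\<close> or
  \<open>yR ^ q - 1\<close>; one variable is moved at a time, by induction over the integers in both
  directions.\<close>

lemma mono_reduce:
  fixes q :: nat
  defines "K \<equiv> ideal_gen {xR ^ q - 1, yR ^ q - 1}"
  shows "mono i j - mono (i mod int q) (j mod int q) \<in> K"
proof -
  have x: "mono (i + int q * k) j - mono i j \<in> K" for i j k
  proof (induction k rule: int_induct[where k = 0])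
    case (step1 k)
    have "mono (i + int q * (k + 1)) j - mono i j =
        mono (i + int q * k) j * (xR ^ q - 1) + (mono (i + int q * k) j - mono i j)"
      by (simp add: xR_power mono_mult algebra_simps)
    then show ?case
      unfolding K_def by (simp only:) (intro ideal_gen.add ideal_gen.gen step1(2)[unfolded K_def], simp)
  next
    case (step2 k)
    have "mono (i + int q * (k - 1)) j - mono i j =
        (mono (i + int q * k) j - mono i j) - mono (i + int q * (k - 1)) j * (xR ^ q - 1)"
      by (simp add: xR_power mono_mult algebra_simps)
    then show ?case
      unfolding K_def by (simp only:) (intro is_idealD(6)[OF is_ideal_ideal_gen] ideal_gen.gen step2(2)[unfolded K_def], simp)
  qed (simp add: K_def ideal_gen.zero)
  have y: "mono i (j + int q * k) - mono i j \<in> K" for i j k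
  proof (induction k rule: int_induct[where k = 0])
    case (step1 k)
    have "mono i (j + int q * (k + 1)) - mono i j =
        mono i (j + int q * k) * (yR ^ q - 1) + (mono i (j + int q * k) - mono i j)"
      by (simp add: yR_power mono_mult algebra_simps)
    then show ?case
      unfolding K_def by (simp only:) (intro ideal_gen.add ideal_gen.gen step1(2)[unfolded K_def], simp)
  next
    case (step2 k)
    have "mono i (j + int q * (k - 1)) - mono i j =
        (mono i (j + int q * k) - mono i j) - mono i (j + int q * (k - 1)) * (yR ^ q - 1)"
      by (simp add: yR_power mono_mult algebra_simps)
    then show ?case
      unfolding K_def by (simp only:) (intro is_idealD(6)[OF is_ideal_ideal_gen] ideal_gen.gen step2(2)[unfolded K_def], simp)
  qed (simp add: K_def ideal_gen.zero)
  have "mono i j - mono (i mod int q) (j mod int q) =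
      (mono (i mod int q + int q * (i div int q)) (j mod int q + int q * (j div int q))
        - mono (i mod int q) (j mod int q + int q * (j div int q)))
      + (mono (i mod int q) (j mod int q + int q * (j div int q)) - mono (i mod int q) (j mod int q))"
    by simp
  also have "\<dots> \<in> K"
    using x y unfolding K_def by (blast intro: ideal_gen.add)
  finally show ?thesis .
qed

text \<open>The integers \<open>F a b\<close> are the coefficients of the image of \<open>f\<close>
  in the group ring of (Z/q)^2, which is thus handled without forming a quotient.\<close>

lemma reduced_representative:
  assumes "q > 0"
  shows "\<exists>F :: nat \<Rightarrow> nat \<Rightarrow> int.
    f - (\<Sum>a<q. \<Sum>b<q. of_int (F a b) * (xR ^ a * yR ^ b)) \<in> ideal_gen {xR ^ q - 1, yR ^ q - 1}"
proof (induction f rule: Rg_induct)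
  case 1
  show ?case
    by (rule exI[of _ "\<lambda>_ _. 0"]) (simp add: ideal_gen.zero)
next
  case (2 i j)
  define a b where "a = nat (i mod int q)" and "b = nat (j mod int q)"
  have ab: "a < q" "b < q" "int a = i mod int q" "int b = j mod int q"
    using assms by (simp_all add: a_def b_def nat_less_iff)
  have "(\<Sum>c<q. \<Sum>d<q. of_int (if c = a \<and> d = b then 1 else 0) * (xR ^ c * yR ^ d)) =
      (\<Sum>c<q. \<Sum>d<q. if d = b then if c = a then xR ^ c * yR ^ d else 0 else 0)"
    by (intro sum.cong refl) auto
  also have "\<dots> = mono (i mod int q) (j mod int q)"
    using ab by (simp add: xR_power yR_power mono_mult)
  finally show ?case
    using mono_reduce[of i j q] by (intro exI[of _ "\<lambda>c d. if c = a \<and> d = b then 1 else 0"]) simp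
next
  case (3 f g)
  then obtain F G :: "nat \<Rightarrow> nat \<Rightarrow> int" where
    F: "f - (\<Sum>a<q. \<Sum>b<q. of_int (F a b) * (xR ^ a * yR ^ b)) \<in> ideal_gen {xR ^ q - 1, yR ^ q - 1}"
    and G: "g - (\<Sum>a<q. \<Sum>b<q. of_int (G a b) * (xR ^ a * yR ^ b)) \<in> ideal_gen {xR ^ q - 1, yR ^ q - 1}"
    by blast
  show ?case
    using is_idealD(6)[OF is_ideal_ideal_gen F G]
    by (intro exI[of _ "\<lambda>a b. F a b - G a b"]) (simp add: algebra_simps sum_subtractf)
qed

lemma ev_ideal_roots_unity:
  assumes "w ^ q = 1" "z ^ q = 1" "w \<noteq> 0" "z \<noteq> 0" "f \<in> ideal_gen {xR ^ q - 1, yR ^ q - 1}"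
  shows "ev w z f = 0"
  using assms(5) by induction (use assms(1-4) in auto)

section \<open>Fourier inversion on (Z/q)^2\<close>

lemma sum_powers_root_unity:
  fixes z :: complex
  assumes "z ^ q = 1"
  shows "(\<Sum>l<q. z ^ l) = (if z = 1 then of_nat q else 0)"
proof (cases "z = 1")
  case False
  then show ?thesis
    using power_diff_1_geometric[of z q] assms by simp
qed simp

text \<open>Orthogonality: after exchanging the sums, \<open>F b\<close> is multiplied by the sum of
  the powers of one \<open>q\<close>-th root of unity, which equals \<open>1\<close> only for
  \<open>b = a\<close>. Writing \<open>q - a\<close> for \<open>-a\<close> keeps exponents
  natural.\<close>

lemma fourier_inversion:
  fixes \<omega> :: complex
  assumes prim: "\<And>k. \<omega> ^ k = 1 \<longleftrightarrow> q dvd k" and a: "a < q"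
  shows "(\<Sum>c<q. \<omega> ^ (c * (q - a)) * (\<Sum>b<q. F b * \<omega> ^ (c * b))) = of_nat q * F a"
proof -
  have "(\<Sum>c<q. \<omega> ^ (c * (q - a)) * (\<Sum>b<q. F b * \<omega> ^ (c * b))) =
      (\<Sum>c<q. \<Sum>b<q. F b * (\<omega> ^ (q - a + b)) ^ c)"
    by (simp add: sum_distrib_left mult_ac add_mult_distrib2 power_add power_mult_distrib flip: power_mult)
  also have "\<dots> = (\<Sum>b<q. F b * (\<Sum>c<q. (\<omega> ^ (q - a + b)) ^ c))"
    by (subst sum.swap) (simp add: sum_distrib_left)
  also have "\<dots> = (\<Sum>b<q. if b = a then of_nat q * F b else 0)"
  proof (rule sum.cong[OF refl])
    fix b assume b: "b \<in> {..<q}"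
    have "(\<omega> ^ (q - a + b)) ^ q = 1"
      by (simp add: prim flip: power_mult)
    moreover have "\<omega> ^ (q - a + b) = 1 \<longleftrightarrow> b = a"
    proof -
      have "q dvd q - a + b \<longleftrightarrow> b = a"
      proof
        assume "q dvd q - a + b"
        then obtain k where k: "q - a + b = q * k" ..
        \<comment> \<open>A multiple of \<open>q\<close> strictly between \<open>0\<close> and
          \<open>q * 2\<close> is \<open>q\<close> itself.\<close>
        have "q - a + b > 0" "q - a + b < q * 2"
          using a b by auto
        then have "k > 0" "k < 2"
          unfolding k by auto
        then have "k = 1" by simp
        with k a show "b = a" by auto
      qed (use a in auto)
      then show ?thesis by (simp add: prim)
    qed
    ultimately show "F b * (\<Sum>c<q. (\<omega> ^ (q - a + b)) ^ c) = (if b = a then of_nat q * F b else 0)"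
      by (simp add: sum_powers_root_unity)
  qed
  also have "\<dots> = of_nat q * F a"
    using a by simp
  finally show ?thesis .
qed

text \<open>Inversion in both variables leaves only the contribution \<open>G 0 0\<close> of the
  trivial character, so all \<open>F a b\<close> coincide and \<open>f\<close> is, modulo
  \<open>K\<close>, an integral multiple of the product of two norm elements. The value at the
  trivial character stays free.\<close>

lemma vanishing_characters_in_Iq:
  fixes \<omega> :: complex
  assumes q: "q > 0" and prim: "\<And>k. \<omega> ^ k = 1 \<longleftrightarrow> q dvd k"
    and van: "\<And>c d. c < q \<Longrightarrow> d < q \<Longrightarrow> (c, d) \<noteq> (0, 0) \<Longrightarrow> ev (\<omega> ^ c) (\<omega> ^ d) f = 0"
  shows "f \<in> Iq q"
proof -
  define K where "K = ideal_gen {xR ^ q - 1, yR ^ q - 1}"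
  obtain F :: "nat \<Rightarrow> nat \<Rightarrow> int" where
    F: "f - (\<Sum>a<q. \<Sum>b<q. of_int (F a b) * (xR ^ a * yR ^ b)) \<in> K"
    using reduced_representative[OF q] unfolding K_def by blast
  have "\<omega> ^ q = 1"
    by (simp add: prim)
  then have nz: "\<omega> \<noteq> 0"
    using q by (auto simp: power_0_left)
  define G :: "nat \<Rightarrow> nat \<Rightarrow> complex"
    where "G c d = (\<Sum>a<q. \<Sum>b<q. of_int (F a b) * (\<omega> ^ (c * a) * \<omega> ^ (d * b)))" for c d
  have G: "G c d = ev (\<omega> ^ c) (\<omega> ^ d) f" for c d
  proof -
    have "ev (\<omega> ^ c) (\<omega> ^ d) (f - (\<Sum>a<q. \<Sum>b<q. of_int (F a b) * (xR ^ a * yR ^ b))) = 0"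
      using F nz unfolding K_def
      by (intro ev_ideal_roots_unity[of _ q]) (auto simp: prim simp flip: power_mult)
    then show ?thesis
      using nz by (simp add: G_def power_mult)
  qed
  have const: "of_nat q * (of_nat q * of_int (F a b)) = G 0 0" if ab: "a < q" "b < q" for a b
  proof -
    have "(\<Sum>d<q. \<omega> ^ (d * (q - b)) * G c d) = of_nat q * (\<Sum>a<q. of_int (F a b) * \<omega> ^ (c * a))" for c
    proof -
      have "G c d = (\<Sum>b<q. (\<Sum>a<q. of_int (F a b) * \<omega> ^ (c * a)) * \<omega> ^ (d * b))" for d
        unfolding G_def by (subst sum.swap) (simp add: sum_distrib_left sum_distrib_right mult_ac)
      then show ?thesis
        using fourier_inversion[OF prim ab(2), of "\<lambda>b. \<Sum>a<q. of_int (F a b) * \<omega> ^ (c * a)"] by simp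
    qed
    then have "(\<Sum>c<q. \<omega> ^ (c * (q - a)) * (\<Sum>d<q. \<omega> ^ (d * (q - b)) * G c d)) =
        of_nat q * (\<Sum>c<q. \<omega> ^ (c * (q - a)) * (\<Sum>a<q. of_int (F a b) * \<omega> ^ (c * a)))"
      by (simp add: sum_distrib_left mult_ac)
    also have "\<dots> = of_nat q * (of_nat q * of_int (F a b))"
      using fourier_inversion[OF prim ab(1), of "\<lambda>a. of_int (F a b)"] by simp
    finally have "of_nat q * (of_nat q * of_int (F a b)) =
        (\<Sum>c<q. \<omega> ^ (c * (q - a)) * (\<Sum>d<q. \<omega> ^ (d * (q - b)) * G c d))" ..
    also have "\<dots> = (\<Sum>c<q. if c = 0 then G 0 0 else 0)"
    proof (rule sum.cong[OF refl])
      fix c assume c: "c \<in> {..<q}"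
      have *: "G c d = (if d = 0 \<and> c = 0 then G 0 0 else 0)" if "d < q" for d
      proof (cases "d = 0 \<and> c = 0")
        case False
        then have "ev (\<omega> ^ c) (\<omega> ^ d) f = 0"
          using c that by (intro van) auto
        then show ?thesis
          unfolding G using False by (simp only: if_False)
      qed (simp only: if_True simp_thms)
      have "(\<Sum>d<q. \<omega> ^ (d * (q - b)) * G c d) =
          (\<Sum>d<q. \<omega> ^ (d * (q - b)) * (if d = 0 \<and> c = 0 then G 0 0 else 0))"
        using * by (intro sum.cong refl) (simp only: lessThan_iff)
      also have "\<dots> = (\<Sum>d<q. if d = 0 then (if c = 0 then G 0 0 else 0) else 0)"
        by (intro sum.cong refl) simp
      also have "\<dots> = (if c = 0 then G 0 0 else 0)"
        using q by simp
      finally show "\<omega> ^ (c * (q - a)) * (\<Sum>d<q. \<omega> ^ (d * (q - b)) * G c d) = (if c = 0 then G 0 0 else 0)"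
        by simp
    qed
    also have "\<dots> = G 0 0"
      using q by simp
    finally show ?thesis .
  qed
  have F_const: "F a b = F 0 0" if "a < q" "b < q" for a b
  proof -
    have "(of_nat q * (of_nat q * of_int (F a b)) :: complex) = of_nat q * (of_nat q * of_int (F 0 0))"
      using const[OF that] const[OF q q] by simp
    then show ?thesis
      using q by simp
  qed
  have "(\<Sum>a<q. \<Sum>b<q. of_int (F a b) * (xR ^ a * yR ^ b)) = (\<Sum>a<q. \<Sum>b<q. of_int (F 0 0) * (xR ^ a * yR ^ b))"
    by (intro sum.cong refl arg_cong2[where f = "(*)"] arg_cong[where f = of_int] F_const) auto
  also have "\<dots> = of_int (F 0 0) * ((\<Sum>a<q. xR ^ a) * (\<Sum>b<q. yR ^ b))"
    by (simp only: sum_product) (simp only: sum_distrib_left)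
  also have "\<dots> \<in> Iq q"
    by (intro Iq_mult yR_geometric_in_Iq)
  finally have "(\<Sum>a<q. \<Sum>b<q. of_int (F a b) * (xR ^ a * yR ^ b)) \<in> Iq q" .
  moreover have "f - (\<Sum>a<q. \<Sum>b<q. of_int (F a b) * (xR ^ a * yR ^ b)) \<in> Iq q"
    using F power_minus_1_in_Iq[of q] unfolding K_def Iq_def
    by (elim ideal_gen_subset[rotated]) blast
  ultimately have "f - (\<Sum>a<q. \<Sum>b<q. of_int (F a b) * (xR ^ a * yR ^ b)) +
      (\<Sum>a<q. \<Sum>b<q. of_int (F a b) * (xR ^ a * yR ^ b)) \<in> Iq q"
    by (intro Iq_add)
  then show ?thesis
    by (simp only: diff_add_cancel)
qed

section \<open>Powers of the augmentation ideal\<close>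

lemma binomial_prime_minus_1_cong:
  assumes "prime p" "l < p"
  shows "int p dvd int ((p - 1) choose l) - (- 1) ^ l"
  using assms(2)
proof (induction l)
  case (Suc l)
  obtain p' where p': "p = Suc p'"
    using assms(1) by (cases p) auto
  \<comment> \<open>By Pascal's rule \<open>(p - 1) choose Suc l\<close> is this multiple of
    \<open>p\<close> minus \<open>(p - 1) choose l\<close>, so the sign alternates.\<close>
  have "int p dvd int (p choose Suc l)"
    using dvd_choose_prime[of "Suc l" p] assms(1) Suc.prems by simp
  moreover have "int p dvd int ((p - 1) choose l) - (- 1) ^ l"
    using Suc by simp
  ultimately have "int p dvd int (p choose Suc l) - (int ((p - 1) choose l) - (- 1) ^ l)"
    by (rule dvd_diff)
  then show ?case
    by (simp add: p')
qed simp

lemma prime_dvd_neg_one_power: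
  assumes "prime p"
  shows "int p dvd (- 1) ^ (p - 1) - 1"
proof (cases "p = 2")
  case False
  then have "odd p"
    using assms prime_odd_nat[of p] prime_ge_2_nat[of p] by auto
  then show ?thesis by simp
qed simp

text \<open>In the binomial expansion the coefficient of \<open>Z ^ l\<close> is congruent to
  \<open>(- 1) ^ l * (- 1) ^ (p - 1 - l)\<close>, that is to \<open>(- 1) ^ (p - 1)\<close>, hence
  to \<open>1\<close>, also for \<open>p = 2\<close>.\<close>

lemma power_pred_prime_cong:
  fixes Z :: "'a :: comm_ring_1"
  assumes "prime p"
  shows "of_nat p dvd (Z - 1) ^ (p - 1) - (\<Sum>l<p. Z ^ l)"
proof -
  have p: "{..p - 1} = {..<p}"
    using prime_gt_0_nat[OF assms] by auto
  have "(Z - 1) ^ (p - 1) = (\<Sum>l<p. of_nat ((p - 1) choose l) * Z ^ l * (- 1) ^ (p - 1 - l))"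
    using binomial_ring[of Z "- 1" "p - 1"] unfolding p by simp
  then have eq: "(Z - 1) ^ (p - 1) - (\<Sum>l<p. Z ^ l) =
      (\<Sum>l<p. of_int (int ((p - 1) choose l) * (- 1) ^ (p - 1 - l) - 1) * Z ^ l)"
    by (simp add: sum_subtractf algebra_simps)
  have "(of_int (int p) :: 'a) dvd of_int (int ((p - 1) choose l) * (- 1) ^ (p - 1 - l) - 1)"
    if l: "l < p" for l
  proof -
    have "int p dvd (int ((p - 1) choose l) - (- 1) ^ l) * (- 1) ^ (p - 1 - l) + ((- 1) ^ (p - 1) - 1)"
      using binomial_prime_minus_1_cong[OF assms l] prime_dvd_neg_one_power[OF assms] by simp
    moreover have "(- 1 :: int) ^ (p - 1) = (- 1) ^ l * (- 1) ^ (p - 1 - l)"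
      using l by (simp flip: power_add)
    ultimately have "int p dvd int ((p - 1) choose l) * (- 1) ^ (p - 1 - l) - 1"
      by (simp add: algebra_simps)
    then obtain k where "int ((p - 1) choose l) * (- 1) ^ (p - 1 - l) - 1 = int p * k" ..
    then show ?thesis
      by (simp only: of_int_mult) simp
  qed
  then show ?thesis
    unfolding eq by (intro dvd_sum) simp
qed

text \<open>Iterated Frobenius: multiplying the preceding congruence by \<open>b - 1\<close> gives
  \<open>(b - 1) ^ p\<close> congruent to \<open>b ^ p - 1\<close>, and a congruence modulo
  \<open>p\<close> survives taking powers.\<close>

lemma power_prime_power_cong:
  fixes Z :: "'a :: comm_ring_1"
  assumes "prime p"
  shows "of_nat p dvd (Z - 1) ^ (p ^ k) - (Z ^ (p ^ k) - 1)"
proof (induction k)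
  case (Suc k)
  define a b where "a = (Z - 1) ^ (p ^ k)" and "b = Z ^ (p ^ k)"
  have "a - (b - 1) dvd a ^ p - (b - 1) ^ p"
    by (simp add: power_diff_sumr2)
  then have 1: "of_nat p dvd a ^ p - (b - 1) ^ p"
    using Suc unfolding a_def b_def by (rule dvd_trans[rotated])
  obtain p' where p': "p = Suc p'"
    using assms by (cases p) auto
  have "(b - 1) ^ p - (b ^ p - 1) = (b - 1) * ((b - 1) ^ (p - 1) - (\<Sum>l<p. b ^ l))"
    unfolding right_diff_distrib power_diff_1_geometric by (simp add: p')
  then have 2: "of_nat p dvd (b - 1) ^ p - (b ^ p - 1)"
    using power_pred_prime_cong[OF assms, of b] by simp
  have "(Z - 1) ^ (p ^ Suc k) = a ^ p" "Z ^ (p ^ Suc k) = b ^ p"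
    by (simp_all add: a_def b_def mult.commute flip: power_mult)
  then show ?case
    using dvd_add[OF 1 2] by (simp only: diff_add_eq add_diff_cancel_right' add_diff_eq diff_add_cancel)
qed simp

text \<open>The exponent is \<open>p ^ k * (p - 1)\<close>, so the two preceding congruences
  combine. The sum is the cyclotomic polynomial of order \<open>p ^ Suc k\<close> at
  \<open>Z\<close>.\<close>

lemma power_totient_cong:
  fixes Z :: "'a :: comm_ring_1"
  assumes "prime p"
  shows "of_nat p dvd (Z - 1) ^ (p ^ Suc k - p ^ k) - (\<Sum>l<p. (Z ^ (p ^ k)) ^ l)"
proof -
  define a b where "a = (Z - 1) ^ (p ^ k)" and "b = Z ^ (p ^ k)"
  have "a - (b - 1) dvd a ^ (p - 1) - (b - 1) ^ (p - 1)"
    by (simp add: power_diff_sumr2)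
  then have 1: "of_nat p dvd a ^ (p - 1) - (b - 1) ^ (p - 1)"
    using power_prime_power_cong[OF assms] unfolding a_def b_def by (rule dvd_trans[rotated])
  have "p ^ Suc k - p ^ k = p ^ k * (p - 1)"
    by (simp add: right_diff_distrib' mult.commute)
  then have "(Z - 1) ^ (p ^ Suc k - p ^ k) = a ^ (p - 1)"
    by (simp only: a_def power_mult)
  then show ?thesis
    using dvd_add[OF 1 power_pred_prime_cong[OF assms, of b]] by (simp add: b_def)
qed

text \<open>Modulo the cyclotomic value \<open>\<Phi>\<close> the power
  \<open>(Z - 1) ^ \<phi>\<close> is a multiple of \<open>p\<close>, so its \<open>k\<close>-th
  power is a multiple of \<open>p ^ k\<close>. One exponent serves every \<open>j\<close> because it
  is at least \<open>\<phi> * k\<close>.\<close>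

lemma power_mod_cyclotomic:
  fixes Z :: "'a :: comm_ring_1"
  assumes p: "prime p" and j: "1 \<le> j" "j \<le> e"
  shows "\<exists>d r. (Z - 1) ^ (e * (p ^ e - p ^ (e - 1))) =
    of_nat (p ^ (2 * e - j)) * d + r * (\<Sum>l<p. (Z ^ (p ^ (j - 1))) ^ l)"
proof -
  define \<phi> \<Phi> k where "\<phi> = p ^ j - p ^ (j - 1)" and "\<Phi> = (\<Sum>l<p. (Z ^ (p ^ (j - 1))) ^ l)"
    and "k = 2 * e - j"
  have "Suc (j - 1) = j"
    using j by simp
  then obtain v where "(Z - 1) ^ \<phi> - \<Phi> = of_nat p * v"
    using power_totient_cong[OF p, of Z "j - 1"] unfolding \<phi>_def \<Phi>_def by (auto elim: dvdE)
  then have v: "(Z - 1) ^ \<phi> = \<Phi> + of_nat p * v"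
    by (simp add: algebra_simps)
  have "(\<Phi> + of_nat p * v) - of_nat p * v dvd (\<Phi> + of_nat p * v) ^ k - (of_nat p * v) ^ k"
    by (simp add: power_diff_sumr2)
  then obtain r where "(\<Phi> + of_nat p * v) ^ k - (of_nat p * v) ^ k = \<Phi> * r"
    by (auto elim: dvdE)
  then have r: "(Z - 1) ^ (\<phi> * k) = of_nat (p ^ k) * v ^ k + r * \<Phi>"
    by (simp add: power_mult v power_mult_distrib algebra_simps)
  \<comment> \<open>This is the bound needed, since \<open>\<phi> * p ^ (e - j)\<close> equals
    \<open>p ^ e - p ^ (e - 1)\<close>. It rests on \<open>k = e + (e - j)\<close> and
    \<open>1 + n \<le> p ^ n\<close>.\<close>
  have "k \<le> e * p ^ (e - j)"
  proof -
    have "1 + (e - j) \<le> p ^ (e - j)"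
      using prime_ge_2_nat[OF p] by (metis One_nat_def Suc_leI less_exp less_le_trans plus_1_eq_Suc power_mono zero_le)
    then have "e * (1 + (e - j)) \<le> e * p ^ (e - j)"
      by (rule mult_left_mono) simp
    moreover have "k = e + (e - j)"
      using j by (simp add: k_def)
    moreover have "e + (e - j) \<le> e * (1 + (e - j))"
      unfolding distrib_left mult_1_right by (intro add_left_mono) (use j in simp)
    ultimately show ?thesis
      by (simp only: le_trans)
  qed
  then have "\<phi> * k \<le> \<phi> * (e * p ^ (e - j))"
    by (rule mult_left_mono) simp
  also have "\<dots> = e * (p ^ (e - j) * p ^ j - p ^ (e - j) * p ^ (j - 1))"
    by (simp add: \<phi>_def right_diff_distrib' mult_ac)
  also have "\<dots> = e * (p ^ e - p ^ (e - 1))"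
    using j by (simp flip: power_add)
  finally obtain i where "e * (p ^ e - p ^ (e - 1)) = \<phi> * k + i"
    using le_Suc_ex by blast
  then have "(Z - 1) ^ (e * (p ^ e - p ^ (e - 1))) = (Z - 1) ^ (\<phi> * k) * (Z - 1) ^ i"
    by (simp add: power_add)
  also have "\<dots> = of_nat (p ^ k) * (v ^ k * (Z - 1) ^ i) + (r * (Z - 1) ^ i) * \<Phi>"
    unfolding r by (simp add: algebra_simps)
  finally show ?thesis
    unfolding \<Phi>_def k_def by blast
qed

section \<open>Interpolation by norm elements\<close>

text \<open>
  Let \<open>q = p^e\<close>. Modulo \<open>q\<close>, the exponent \<open>t * (q - 1)\<close> is \<open>-t\<close>, so the last factor is \<open>q\<close> at the
  characters of \<open>(Z/q)^2\<close> with \<open>Y = X^t\<close> and \<open>0\<close> at all others, while the last but one is \<open>p^(e-f)\<close>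
  or \<open>0\<close> according to whether \<open>X^(p^f) = 1\<close>. At a character where \<open>X\<close> has order \<open>p^j\<close> only the summands
  with \<open>f \<ge> j\<close> survive, \<open>p^(f-j)\<close> values of \<open>t\<close> contribute to each of them, and the differences of \<open>D\<close>
  telescope. The predicate \<open>T\<close> separates the characters where \<open>Y\<close> is a power of \<open>X\<close> from those where
  only the converse holds.
\<close>

definition interpolant ::
  "nat \<Rightarrow> nat \<Rightarrow> (nat \<Rightarrow> bool) \<Rightarrow> nat \<Rightarrow> (nat \<Rightarrow> 'a) \<Rightarrow> 'a \<Rightarrow> 'a \<Rightarrow> 'a::comm_ring_1" where
  "interpolant p e T n D X Y =
    (\<Sum>f=1..e. \<Sum>t | t < p ^ f \<and> T t.
      (D f - D (Suc f)) * (\<Sum>l<t. X ^ l) ^ n * (\<Sum>l<p ^ (e - f). (X ^ (p ^ f)) ^ l) *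
      (\<Sum>l<p ^ e. (X ^ (t * (p ^ e - 1)) * Y) ^ l))"

lemma ev_interpolant:
  assumes "w \<noteq> 0" "z \<noteq> 0"
  shows "ev w z (interpolant p e T n D X Y) =
    interpolant p e T n (\<lambda>f. ev w z (D f)) (ev w z X) (ev w z Y)"
  using assms by (simp add: interpolant_def)

text \<open>The last factor of every summand is the norm element of a monomial; the remaining
  factors are mere coefficients.\<close>

lemma interpolant_in_Iq:
  "interpolant p e T n D xR yR \<in> Iq (p ^ e)" "interpolant p e T n D yR xR \<in> Iq (p ^ e)"
proof -
  have "\<exists>i j. xR ^ t * yR = mono i j" "\<exists>i j. yR ^ t * xR = mono i j" for t
    by (auto simp: xR_def yR_def mono_power mono_mult)
  then have *: "(\<Sum>l<q. (xR ^ t * yR) ^ l) \<in> Iq q" "(\<Sum>l<q. (yR ^ t * xR) ^ l) \<in> Iq q" for q t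
    by (metis geometric_in_Iq)+
  show "interpolant p e T n D xR yR \<in> Iq (p ^ e)" "interpolant p e T n D yR xR \<in> Iq (p ^ e)"
    unfolding interpolant_def by (rule Iq_sum, rule Iq_sum, rule Iq_mult, rule *)+
qed

lemma card_residue_class:
  fixes d m s :: nat
  assumes "d > 0"
  shows "card {t. t < d * m \<and> t mod d = s mod d} = m"
proof -
  have "bij_betw (\<lambda>i. d * i + s mod d) {..<m} {t. t < d * m \<and> t mod d = s mod d}"
  proof (rule bij_betwI[of _ _ _ "\<lambda>t. t div d"])
    show "(\<lambda>i. d * i + s mod d) \<in> {..<m} \<rightarrow> {t. t < d * m \<and> t mod d = s mod d}"
    proof
      fix i assume "i \<in> {..<m}"
      then have "d * Suc i \<le> d * m"
        by (intro mult_left_mono) auto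
      moreover have "s mod d < d"
        using assms by simp
      ultimately show "d * i + s mod d \<in> {t. t < d * m \<and> t mod d = s mod d}"
        by simp
    qed
    show "(\<lambda>t. t div d) \<in> {t. t < d * m \<and> t mod d = s mod d} \<rightarrow> {..<m}"
      using assms by (auto simp: div_less_iff_less_mult mult.commute)
  next
    fix t assume "t \<in> {t. t < d * m \<and> t mod d = s mod d}"
    then have "t mod d = s mod d" by simp
    then show "d * (t div d) + s mod d = t"
      using mult_div_mod_eq[of d t] by simp
  qed (use assms in auto)
  then show ?thesis
    by (simp add: bij_betw_same_card[symmetric])
qed

text \<open>For the surviving \<open>t\<close> one has \<open>\<zeta> ^ t = \<zeta> ^ s\<close>, so
  the geometric sum over \<open>l < t\<close> is always the same quotient. The powers of
  \<open>p\<close> multiply to \<open>p ^ (2 * e - j)\<close> for each \<open>f \<ge> j\<close>, and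
  the telescoping sum ends at \<open>D (Suc e) = 0\<close>.\<close>

lemma interpolant_eval:
  fixes \<zeta> :: complex
  assumes p: "prime p" and j: "1 \<le> j" "j \<le> e"
    and prim: "\<And>i. \<zeta> ^ i = 1 \<longleftrightarrow> p ^ j dvd i"
    and T: "\<And>t. t mod p ^ j = s mod p ^ j \<Longrightarrow> T t" and D: "D (Suc e) = 0"
  shows "interpolant p e T n D \<zeta> (\<zeta> ^ s) =
    of_nat (p ^ (2 * e - j)) * D j * ((\<zeta> ^ s - 1) / (\<zeta> - 1)) ^ n"
proof -
  define R where "R = ((\<zeta> ^ s - 1) / (\<zeta> - 1)) ^ n"
  have p0: "p > 0" and p1: "p > 1"
    using prime_gt_0_nat[OF p] prime_gt_1_nat[OF p] by auto
  have \<zeta>1: "\<zeta> \<noteq> 1"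
    using prim[of 1] p1 j by simp
  have q: "p ^ j dvd p ^ e"
    using j by (simp add: le_imp_power_dvd)
  have A: "(\<Sum>l<p ^ (e - f). (\<zeta> ^ (p ^ f)) ^ l) = (if j \<le> f then of_nat (p ^ (e - f)) else 0)"
    if f: "f \<le> e" for f
  proof -
    have "(\<zeta> ^ (p ^ f)) ^ (p ^ (e - f)) = 1"
      using f q by (simp add: prim flip: power_mult power_add)
    moreover have "\<zeta> ^ (p ^ f) = 1 \<longleftrightarrow> j \<le> f"
      using p1 by (simp add: prim dvd_power_iff_le)
    ultimately show ?thesis
      by (simp add: sum_powers_root_unity)
  qed
  have B: "(\<Sum>l<p ^ e. (\<zeta> ^ (t * (p ^ e - 1)) * \<zeta> ^ s) ^ l) =
      (if t mod p ^ j = s mod p ^ j then of_nat (p ^ e) else 0)" for t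
  proof -
    have eq: "\<zeta> ^ (t * (p ^ e - 1)) * \<zeta> ^ s = \<zeta> ^ (t * (p ^ e - 1) + s)"
      by (simp add: power_add)
    have "(\<zeta> ^ (t * (p ^ e - 1) + s)) ^ (p ^ e) = 1"
      using q by (simp add: prim flip: power_mult)
    moreover have "p ^ j dvd t * (p ^ e - 1) + s \<longleftrightarrow> t mod p ^ j = s mod p ^ j"
    proof -
      have "int (p ^ e - 1) = int p ^ e - 1"
        using p0 by (simp add: of_nat_diff)
      then have "int (t * (p ^ e - 1) + s) = int t * int p ^ e - (int t - int s)"
        by (simp only: of_nat_add of_nat_mult) (simp add: algebra_simps)
      moreover have "int (p ^ j) dvd int t * int p ^ e"
        using j by (simp add: le_imp_power_dvd)
      ultimately have "int (p ^ j) dvd int (t * (p ^ e - 1) + s) \<longleftrightarrow> int (p ^ j) dvd int t - int s"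
        by (simp only: dvd_diff_right_iff)
      also have "\<dots> \<longleftrightarrow> int t mod int (p ^ j) = int s mod int (p ^ j)"
        by (simp only: mod_eq_dvd_iff)
      also have "\<dots> \<longleftrightarrow> t mod p ^ j = s mod p ^ j"
        by (simp only: of_nat_mod[symmetric] of_nat_eq_iff)
      finally show ?thesis
        by (simp only: of_nat_dvd_iff)
    qed
    ultimately show ?thesis
      unfolding eq by (simp add: sum_powers_root_unity prim)
  qed
  have C: "(\<Sum>l<t. \<zeta> ^ l) ^ n = R" if "t mod p ^ j = s mod p ^ j" for t
  proof -
    have mod: "\<zeta> ^ i = \<zeta> ^ (i mod p ^ j)" for i
    proof -
      have "\<zeta> ^ i = \<zeta> ^ (p ^ j * (i div p ^ j) + i mod p ^ j)"
        by simp
      also have "\<dots> = \<zeta> ^ (p ^ j * (i div p ^ j)) * \<zeta> ^ (i mod p ^ j)"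
        by (rule power_add)
      also have "\<zeta> ^ (p ^ j * (i div p ^ j)) = 1"
        by (simp only: prim dvd_triv_left)
      finally show ?thesis by simp
    qed
    have "\<zeta> ^ t = \<zeta> ^ s"
      using mod[of t] mod[of s] that by simp
    then have "(\<zeta> - 1) * (\<Sum>l<t. \<zeta> ^ l) = \<zeta> ^ s - 1"
      by (simp only: power_diff_1_geometric)
    then have "(\<Sum>l<t. \<zeta> ^ l) = (\<zeta> ^ s - 1) / (\<zeta> - 1)"
      using \<zeta>1 by (simp add: field_simps)
    then show ?thesis
      by (simp add: R_def)
  qed
  have "interpolant p e T n D \<zeta> (\<zeta> ^ s) =
      (\<Sum>f=1..e. if j \<le> f then of_nat (p ^ (2 * e - j)) * R * (D f - D (Suc f)) else 0)"
    unfolding interpolant_def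
  proof (rule sum.cong[OF refl])
    fix f assume f: "f \<in> {1..e}"
    have "(\<Sum>t | t < p ^ f \<and> T t.
        (D f - D (Suc f)) * (\<Sum>l<t. \<zeta> ^ l) ^ n * (\<Sum>l<p ^ (e - f). (\<zeta> ^ (p ^ f)) ^ l) *
        (\<Sum>l<p ^ e. (\<zeta> ^ (t * (p ^ e - 1)) * \<zeta> ^ s) ^ l)) =
      (\<Sum>t | t < p ^ f \<and> T t. if t mod p ^ j = s mod p ^ j then
        (D f - D (Suc f)) * R * (if j \<le> f then of_nat (p ^ (e - f)) else 0) * of_nat (p ^ e) else 0)"
      using f by (intro sum.cong refl) (simp add: A B[unfolded One_nat_def] C)
    \<comment> \<open>\<open>T\<close> may be dropped: it holds throughout the residue class of
      \<open>s\<close>, and all other summands vanish.\<close>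
    also have "\<dots> = (\<Sum>t | t < p ^ f \<and> t mod p ^ j = s mod p ^ j.
        (D f - D (Suc f)) * R * (if j \<le> f then of_nat (p ^ (e - f)) else 0) * of_nat (p ^ e))"
      by (intro sum.mono_neutral_cong_right) (use T in auto)
    also have "\<dots> = (if j \<le> f then of_nat (p ^ (2 * e - j)) * R * (D f - D (Suc f)) else 0)"
    proof (cases "j \<le> f")
      case True
      have "p ^ f = p ^ j * p ^ (f - j)"
        using True by (simp flip: power_add)
      then have card: "card {t. t < p ^ f \<and> t mod p ^ j = s mod p ^ j} = p ^ (f - j)"
        using card_residue_class[of "p ^ j" "p ^ (f - j)" s] p0 by simp
      \<comment> \<open>The exponents come from the number of \<open>t\<close>, the third factor and
        the last factor; \<open>f\<close> cancels.\<close>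
      have "2 * e - j = (f - j) + (e - f) + e"
        using True f by simp
      then have "(of_nat (p ^ (2 * e - j)) :: complex) = of_nat (p ^ (f - j)) * of_nat (p ^ (e - f)) * of_nat (p ^ e)"
        by (simp only: power_add of_nat_mult)
      with True show ?thesis
        by (simp add: card mult_ac)
    qed simp
    finally show "(\<Sum>t | t < p ^ f \<and> T t.
        (D f - D (Suc f)) * (\<Sum>l<t. \<zeta> ^ l) ^ n * (\<Sum>l<p ^ (e - f). (\<zeta> ^ (p ^ f)) ^ l) *
        (\<Sum>l<p ^ e. (\<zeta> ^ (t * (p ^ e - 1)) * \<zeta> ^ s) ^ l)) =
      (if j \<le> f then of_nat (p ^ (2 * e - j)) * R * (D f - D (Suc f)) else 0)" .
  qed
  also have "\<dots> = (\<Sum>f=j..e. of_nat (p ^ (2 * e - j)) * R * (D f - D (Suc f)))"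
    using j by (intro sum.mono_neutral_cong_right) auto
  also have "\<dots> = of_nat (p ^ (2 * e - j)) * R * (\<Sum>f=j..e. D f - D (Suc f))"
    by (simp only: sum_distrib_left)
  also have "(\<Sum>f=j..e. D f - D (Suc f)) = D j"
    using sum_Suc_diff[of j e "\<lambda>f. - D f"] j D by simp
  finally show ?thesis
    by (simp add: R_def mult_ac)
qed

text \<open>With the roles exchanged, the last factor sums the powers of \<open>\<zeta>\<close>
  raised to an exponent that is \<open>1\<close> modulo \<open>p\<close>. This root of unity is
  never \<open>1\<close>, so the sum vanishes.\<close>

lemma interpolant_eval_0:
  fixes \<zeta> :: complex
  assumes p: "prime p" and j: "1 \<le> j" "j \<le> e"
    and prim: "\<And>i. \<zeta> ^ i = 1 \<longleftrightarrow> p ^ j dvd i"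
    and T: "\<And>t. T t \<Longrightarrow> p dvd s * t"
  shows "interpolant p e T n D (\<zeta> ^ s) \<zeta> = 0"
proof -
  have B: "(\<Sum>l<p ^ e. ((\<zeta> ^ s) ^ (t * (p ^ e - 1)) * \<zeta>) ^ l) = 0" if "T t" for t
  proof -
    have eq: "(\<zeta> ^ s) ^ (t * (p ^ e - 1)) * \<zeta> = \<zeta> ^ (s * t * (p ^ e - 1) + 1)"
      by (simp add: mult.assoc flip: power_mult)
    have "p ^ j dvd p ^ e"
      using j by (simp add: le_imp_power_dvd)
    then have "(\<zeta> ^ (s * t * (p ^ e - 1) + 1)) ^ (p ^ e) = 1"
      unfolding power_mult[symmetric] prim by (rule dvd_mult)
    moreover have "\<not> p ^ j dvd s * t * (p ^ e - 1) + 1"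
    proof
      assume "p ^ j dvd s * t * (p ^ e - 1) + 1"
      moreover have "p dvd p ^ j"
        using j by simp
      ultimately have "p dvd s * t * (p ^ e - 1) + 1"
        by (rule dvd_trans[rotated])
      moreover have "p dvd s * t * (p ^ e - 1)"
        using T[OF that] by (rule dvd_mult2)
      ultimately have "p dvd 1"
        using dvd_add_right_iff by blast
      with p show False
        by (simp add: not_prime_unit)
    qed
    ultimately show ?thesis
      unfolding eq by (simp only: sum_powers_root_unity prim if_False)
  qed
  show ?thesis
    unfolding interpolant_def by (intro sum.neutral ballI) (use B in simp)
qed

section \<open>Characters of (Z/p^e)^2 and the combination of norm elements\<close>

lemma primitive_root_exists:
  assumes "q > 0"
  shows "\<exists>\<omega> :: complex. \<forall>k. \<omega> ^ k = 1 \<longleftrightarrow> q dvd k"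
proof -
  define \<omega> where "\<omega> = cis (2 * pi / real q)"
  have pow: "\<omega> ^ k = cis (2 * pi * real k / real q)" for k
    unfolding \<omega>_def by (simp add: DeMoivre mult_ac)
  have "\<omega> ^ q = 1"
    using assms by (simp add: pow)
  have "\<omega> ^ k = 1 \<longleftrightarrow> q dvd k" for k
  proof -
    have "\<omega> ^ k = \<omega> ^ (q * (k div q) + k mod q)"
      by simp
    also have "\<dots> = \<omega> ^ (k mod q)"
      using \<open>\<omega> ^ q = 1\<close> by (simp only: power_add power_mult power_one mult_1)
    finally have "\<omega> ^ k = 1 \<longleftrightarrow> \<omega> ^ (k mod q) = \<omega> ^ 0"
      by simp
    also have "\<dots> \<longleftrightarrow> k mod q = 0"
      using bij_betw_imp_inj_on[OF bij_betw_roots_unity[OF assms]] assms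
      unfolding pow by (subst inj_on_eq_iff[where f = "\<lambda>k. cis (2 * pi * real k / real q)"]) auto
    finally show ?thesis
      by (simp add: dvd_eq_mod_eq_0)
  qed
  then show ?thesis
    by blast
qed

text \<open>The part \<open>c'\<close> prime to \<open>p\<close> is invertible modulo
  \<open>p ^ e\<close>, so \<open>\<omega> ^ c\<close> generates the same cyclic group as
  \<open>\<omega> ^ (p ^ \<alpha>)\<close>.\<close>

lemma primitive_root_power:
  fixes \<omega> :: complex
  assumes p: "prime p" and prim: "\<And>k. \<omega> ^ k = 1 \<longleftrightarrow> p ^ e dvd k"
    and c: "c = c' * p ^ \<alpha>" "\<not> p dvd c'" "\<alpha> < e"
  shows "(\<omega> ^ c) ^ i = 1 \<longleftrightarrow> p ^ (e - \<alpha>) dvd i"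
    and "p ^ \<alpha> dvd d \<Longrightarrow> \<exists>s. \<omega> ^ d = (\<omega> ^ c) ^ s \<and> (p ^ Suc \<alpha> dvd d \<longrightarrow> p dvd s)"
proof -
  have p0: "p > 0"
    using prime_gt_0_nat[OF p] .
  have cop: "coprime (p ^ n) c'" for n
    using p c(2) by (simp add: prime_imp_coprime)
  have "p ^ e = p ^ \<alpha> * p ^ (e - \<alpha>)"
    using c(3) by (simp flip: power_add)
  moreover have "c * i = p ^ \<alpha> * (c' * i)"
    by (simp add: c(1) mult_ac)
  ultimately have "p ^ e dvd c * i \<longleftrightarrow> p ^ \<alpha> * p ^ (e - \<alpha>) dvd p ^ \<alpha> * (c' * i)"
    by (simp only:)
  also have "\<dots> \<longleftrightarrow> p ^ (e - \<alpha>) dvd c' * i"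
    using p0 by simp
  also have "\<dots> \<longleftrightarrow> p ^ (e - \<alpha>) dvd i"
    using cop by (rule coprime_dvd_mult_right_iff)
  finally show "(\<omega> ^ c) ^ i = 1 \<longleftrightarrow> p ^ (e - \<alpha>) dvd i"
    by (simp add: prim flip: power_mult)
  show "\<exists>s. \<omega> ^ d = (\<omega> ^ c) ^ s \<and> (p ^ Suc \<alpha> dvd d \<longrightarrow> p dvd s)" if d: "p ^ \<alpha> dvd d"
  proof -
    obtain d' where d': "d = p ^ \<alpha> * d'"
      using d ..
    have "c' \<noteq> 0"
      using c(2) by (metis dvd_0_right)
    \<comment> \<open>Bezout makes \<open>x\<close> an inverse of \<open>c'\<close> modulo
      \<open>p ^ e\<close>.\<close>
    then obtain x y where "c' * x = p ^ e * y + gcd c' (p ^ e)"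
      using bezout_nat by blast
    moreover have "gcd c' (p ^ e) = 1"
      using cop[of e] by (simp add: coprime_iff_gcd_eq_1 gcd.commute)
    ultimately have xy: "c' * x = p ^ e * y + 1"
      by simp
    have "c * (x * d') = (c' * x) * d"
      by (simp add: c(1) d' mult_ac)
    also have "\<dots> = p ^ e * (y * d) + d"
      by (simp add: xy algebra_simps)
    finally have "(\<omega> ^ c) ^ (x * d') = \<omega> ^ (p ^ e * (y * d) + d)"
      by (simp only: power_mult[symmetric])
    also have "\<dots> = \<omega> ^ (p ^ e * (y * d)) * \<omega> ^ d"
      by (rule power_add)
    also have "\<omega> ^ (p ^ e * (y * d)) = 1"
      by (simp only: prim dvd_triv_left)
    finally have "\<omega> ^ d = (\<omega> ^ c) ^ (x * d')"
      by simp
    moreover have "p dvd x * d'" if "p ^ Suc \<alpha> dvd d"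
      using that p0 by (simp add: d')
    ultimately show ?thesis
      by blast
  qed
qed

text \<open>The exponent of smaller \<open>p\<close>-adic valuation yields the generator
  \<open>\<zeta>\<close>. Ties go to \<open>c\<close>, so in the second alternative the valuation of
  \<open>c\<close> is strictly larger, whence \<open>p dvd s\<close>.\<close>

lemma root_unity_pair_cases:
  fixes \<omega> :: complex
  assumes p: "prime p" and prim: "\<And>k. \<omega> ^ k = 1 \<longleftrightarrow> p ^ e dvd k"
    and cd: "c < p ^ e" "d < p ^ e" "(c, d) \<noteq> (0, 0)"
  obtains \<zeta> j s where "1 \<le> j" "j \<le> e" "\<And>i. \<zeta> ^ i = 1 \<longleftrightarrow> p ^ j dvd i"
    "\<omega> ^ c = \<zeta> \<and> \<omega> ^ d = \<zeta> ^ s \<or> \<omega> ^ d = \<zeta> \<and> \<omega> ^ c = \<zeta> ^ s \<and> p dvd s"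
proof -
  have split: "\<exists>\<alpha> a'. a = a' * p ^ \<alpha> \<and> \<not> p dvd a' \<and> \<alpha> < e" if "0 < a" "a < p ^ e" for a
  proof -
    obtain \<alpha> a' where a: "\<not> p dvd a'" "a = a' * p ^ \<alpha>"
      using prime_power_canonical[OF p] \<open>0 < a\<close> by blast
    then have "p ^ \<alpha> \<le> a"
      using \<open>0 < a\<close> by simp
    then have "p ^ \<alpha> < p ^ e"
      using that by linarith
    then have "\<alpha> < e"
      using prime_gt_1_nat[OF p] by (simp add: power_strict_increasing_iff)
    with a show ?thesis by blast
  qed
  note result = that
  have fst: thesis if c: "c = c' * p ^ \<alpha>" "\<not> p dvd c'" "\<alpha> < e" "p ^ \<alpha> dvd d" for c' \<alpha>
  proof -
    obtain s where "\<omega> ^ d = (\<omega> ^ c) ^ s"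
      using primitive_root_power(2)[OF p prim c] by blast
    then show thesis
      using primitive_root_power(1)[OF p prim c(1-3)] c(3)
      by (intro result[of "e - \<alpha>" "\<omega> ^ c" s]) auto
  qed
  have snd: thesis if d: "d = d' * p ^ \<beta>" "\<not> p dvd d'" "\<beta> < e" "p ^ Suc \<beta> dvd c" for d' \<beta>
  proof -
    have "p ^ \<beta> dvd c"
      using d(4) by (rule dvd_trans[rotated]) simp
    then obtain s where "\<omega> ^ c = (\<omega> ^ d) ^ s" "p dvd s"
      using primitive_root_power(2)[OF p prim d(1-3) \<open>p ^ \<beta> dvd c\<close>] d(4) by blast
    then show thesis
      using primitive_root_power(1)[OF p prim d(1-3)] d(3)
      by (intro result[of "e - \<beta>" "\<omega> ^ d" s]) auto
  qed
  show thesis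
  proof (cases "c = 0 \<or> d = 0")
    case True
    \<comment> \<open>Zero is divisible by every power of \<open>p\<close>, so the nonzero exponent
      yields the generator.\<close>
    then show thesis
      using split[of c] split[of d] cd fst snd by auto
  next
    case False
    then obtain c' \<alpha> d' \<beta> where c: "c = c' * p ^ \<alpha>" "\<not> p dvd c'" "\<alpha> < e"
      and d: "d = d' * p ^ \<beta>" "\<not> p dvd d'" "\<beta> < e"
      using split[of c] split[of d] cd by blast
    show thesis
    proof (cases "\<alpha> \<le> \<beta>")
      case True
      then have "p ^ \<alpha> dvd d"
        unfolding d(1) by (intro dvd_mult le_imp_power_dvd)
      with c show thesis by (rule fst)
    next
      case False
      then have "p ^ Suc \<beta> dvd c"
        unfolding c(1) by (intro dvd_mult le_imp_power_dvd) simp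
      with d show thesis by (rule snd)
    qed
  qed
qed

text \<open>At \<open>(\<zeta>, \<zeta> ^ s)\<close> the product is
  \<open>(\<zeta> - 1) ^ N * ((\<zeta> ^ s - 1) / (\<zeta> - 1)) ^ n\<close>, the value of an
  interpolant whose \<open>D j\<close> is \<open>(\<zeta> - 1) ^ N\<close> divided by
  \<open>p ^ (2 * e - j)\<close>. Two interpolants, one with each variable as base, cover all
  nontrivial characters.\<close>

lemma augmentation_power_in_Iq:
  assumes p: "prime p" and e: "e \<ge> 1" and mn: "m + n = e * (p ^ e - p ^ (e - 1))"
  shows "(xR - 1) ^ m * (yR - 1) ^ n \<in> Iq (p ^ e)"
proof -
  define N where "N = e * (p ^ e - p ^ (e - 1))"
  have N: "N = m + n"
    by (simp only: N_def mn)
  have p0: "p > 0" and p1: "p > 1"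
    using prime_gt_0_nat[OF p] prime_gt_1_nat[OF p] by auto
  have "\<exists>D. D (Suc e) = 0 \<and> (\<forall>j\<in>{1..e}. \<exists>r. (Z - 1) ^ N =
      of_nat (p ^ (2 * e - j)) * D j + r * (\<Sum>l<p. (Z ^ (p ^ (j - 1))) ^ l))" for Z :: Rg
  proof -
    have "\<forall>j\<in>{1..e}. \<exists>d r. (Z - 1) ^ N =
        of_nat (p ^ (2 * e - j)) * d + r * (\<Sum>l<p. (Z ^ (p ^ (j - 1))) ^ l)"
      unfolding N_def using power_mod_cyclotomic[OF p] by auto
    then obtain D where "\<forall>j\<in>{1..e}. \<exists>r. (Z - 1) ^ N =
        of_nat (p ^ (2 * e - j)) * D j + r * (\<Sum>l<p. (Z ^ (p ^ (j - 1))) ^ l)"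
      by metis
    \<comment> \<open>The index \<open>Suc e\<close> lies outside \<open>{1..e}\<close>; the value
      \<open>0\<close> there ends the telescoping.\<close>
    then show ?thesis
      by (intro exI[of _ "\<lambda>j. if j = Suc e then 0 else D j"]) auto
  qed
  then obtain D where D0: "D Z (Suc e) = 0" and D: "\<And>j. j \<in> {1..e} \<Longrightarrow> \<exists>r. (Z - 1) ^ N =
      of_nat (p ^ (2 * e - j)) * D Z j + r * (\<Sum>l<p. (Z ^ (p ^ (j - 1))) ^ l)" for Z :: Rg
    by metis
  \<comment> \<open>The cyclotomic factor vanishes at roots of unity of order \<open>p ^ j\<close>,
    so \<open>D Z j\<close> evaluates to the exact quotient.\<close>
  have evD: "of_nat (p ^ (2 * e - j)) * ev w z (D Z j) = (ev w z Z - 1) ^ N"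
    if wz: "w \<noteq> 0" "z \<noteq> 0" and j: "1 \<le> j" "j \<le> e" and prim: "\<And>i. ev w z Z ^ i = 1 \<longleftrightarrow> p ^ j dvd i"
    for w z Z j
  proof -
    have "p ^ (j - 1) * p = p ^ j"
      using j by (simp flip: power_Suc2)
    then have "(ev w z Z ^ (p ^ (j - 1))) ^ p = 1"
      by (simp only: power_mult[symmetric] prim dvd_refl)
    moreover have "ev w z Z ^ (p ^ (j - 1)) \<noteq> 1"
      using p1 j by (simp add: prim dvd_power_iff_le)
    ultimately have "(\<Sum>l<p. (ev w z Z ^ (p ^ (j - 1))) ^ l) = 0"
      by (simp add: sum_powers_root_unity)
    moreover obtain r where "(Z - 1) ^ N =
        of_nat (p ^ (2 * e - j)) * D Z j + r * (\<Sum>l<p. (Z ^ (p ^ (j - 1))) ^ l)"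
      using D[of j Z] j by auto
    then have "ev w z ((Z - 1) ^ N) =
        ev w z (of_nat (p ^ (2 * e - j)) * D Z j + r * (\<Sum>l<p. (Z ^ (p ^ (j - 1))) ^ l))"
      by simp
    ultimately show ?thesis
      using wz by simp
  qed
  define z where "z = (xR - 1) ^ m * (yR - 1) ^ n"
  \<comment> \<open>\<open>E'\<close> must vanish wherever Y is a power of X, hence its restriction
    to \<open>p dvd t\<close>. Where it has to interpolate, \<open>p dvd s\<close> puts all relevant
    \<open>t\<close> in that range, and also makes \<open>E\<close> vanish.\<close>
  define E where "E = interpolant p e (\<lambda>_. True) n (D xR) xR yR"
  define E' where "E' = interpolant p e (\<lambda>t. p dvd t) m (D yR) yR xR"
  obtain \<omega> :: complex where prim: "\<And>k. \<omega> ^ k = 1 \<longleftrightarrow> p ^ e dvd k"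
    using primitive_root_exists[of "p ^ e"] p0 by auto
  have "z - E - E' \<in> Iq (p ^ e)"
  proof (rule vanishing_characters_in_Iq[OF _ prim])
    fix c d assume cd: "c < p ^ e" "d < p ^ e" "(c, d) \<noteq> (0, 0)"
    obtain \<zeta> j s where j: "1 \<le> j" "j \<le> e" and \<zeta>: "\<And>i. \<zeta> ^ i = 1 \<longleftrightarrow> p ^ j dvd i"
      and cases: "\<omega> ^ c = \<zeta> \<and> \<omega> ^ d = \<zeta> ^ s \<or> \<omega> ^ d = \<zeta> \<and> \<omega> ^ c = \<zeta> ^ s \<and> p dvd s"
      by (rule root_unity_pair_cases[OF p prim cd]) (rule that; assumption)
    have \<zeta>1: "\<zeta> \<noteq> 1"
      using \<zeta>[of 1] p1 j by simp
    have "\<zeta> \<noteq> 0"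
      using \<zeta>[of "p ^ j"] p0 by (auto simp: power_0_left)
    show "ev (\<omega> ^ c) (\<omega> ^ d) (z - E - E') = 0"
      using cases
    proof
      assume "\<omega> ^ c = \<zeta> \<and> \<omega> ^ d = \<zeta> ^ s"
      then have cd: "\<omega> ^ c = \<zeta>" "\<omega> ^ d = \<zeta> ^ s" by auto
      have "ev \<zeta> (\<zeta> ^ s) E = (\<zeta> - 1) ^ N * ((\<zeta> ^ s - 1) / (\<zeta> - 1)) ^ n"
        unfolding E_def using \<open>\<zeta> \<noteq> 0\<close> evD[of \<zeta> "\<zeta> ^ s" j xR] j \<zeta>
        by (simp add: ev_interpolant interpolant_eval[OF p j \<zeta>] D0)
      also have "\<dots> = ev \<zeta> (\<zeta> ^ s) z"
        using \<open>\<zeta> \<noteq> 0\<close> \<zeta>1 by (simp add: z_def N power_add power_divide)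
      finally have "ev \<zeta> (\<zeta> ^ s) E = ev \<zeta> (\<zeta> ^ s) z" .
      moreover have "ev \<zeta> (\<zeta> ^ s) E' = 0"
        unfolding E'_def using \<open>\<zeta> \<noteq> 0\<close> by (simp add: ev_interpolant interpolant_eval_0[OF p j \<zeta>])
      ultimately show ?thesis
        by (simp add: cd)
    next
      assume "\<omega> ^ d = \<zeta> \<and> \<omega> ^ c = \<zeta> ^ s \<and> p dvd s"
      then have cd: "\<omega> ^ d = \<zeta>" "\<omega> ^ c = \<zeta> ^ s" and s: "p dvd s" by auto
      have T: "p dvd t" if "t mod p ^ j = s mod p ^ j" for t
      proof -
        have "p dvd p ^ j"
          using j by simp
        then show ?thesis
          using s dvd_mod_iff[of p "p ^ j" t] dvd_mod_iff[of p "p ^ j" s] that by simp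
      qed
      have "ev (\<zeta> ^ s) \<zeta> E' = (\<zeta> - 1) ^ N * ((\<zeta> ^ s - 1) / (\<zeta> - 1)) ^ m"
        unfolding E'_def using \<open>\<zeta> \<noteq> 0\<close> evD[of "\<zeta> ^ s" \<zeta> j yR] j \<zeta>
        by (simp add: ev_interpolant interpolant_eval[OF p j \<zeta> T] D0)
      also have "\<dots> = ev (\<zeta> ^ s) \<zeta> z"
        using \<open>\<zeta> \<noteq> 0\<close> \<zeta>1 by (simp add: z_def N power_add power_divide)
      finally have "ev (\<zeta> ^ s) \<zeta> E' = ev (\<zeta> ^ s) \<zeta> z" .
      moreover have "ev (\<zeta> ^ s) \<zeta> E = 0"
        unfolding E_def using \<open>\<zeta> \<noteq> 0\<close> s by (simp add: ev_interpolant interpolant_eval_0[OF p j \<zeta>])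
      ultimately show ?thesis
        by (simp add: cd)
    qed
  qed (use p0 in auto)
  moreover have "E \<in> Iq (p ^ e)" "E' \<in> Iq (p ^ e)"
    unfolding E_def E'_def by (rule interpolant_in_Iq)+
  ultimately have "z - E - E' + (E + E') \<in> Iq (p ^ e)"
    by (intro Iq_add)
  then show ?thesis
    by (simp add: z_def)
qed

section \<open>Congruence filtration of the matrix group\<close>

instantiation mat2 :: (comm_ring_1) ring_1
begin

definition "0 = M2 0 0 0 0"

definition "1 = mone"

fun plus_mat2 where
  "M2 a b c d + M2 a' b' c' d' = M2 (a + a') (b + b') (c + c') (d + d')"

fun minus_mat2 where
  "M2 a b c d - M2 a' b' c' d' = M2 (a - a') (b - b') (c - c') (d - d')"

fun uminus_mat2 where
  "- M2 a b c d = M2 (- a) (- b) (- c) (- d)"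

definition "A * B = mmul A B"

instance
proof
  fix A B C :: "'a mat2"
  show "A * B * C = A * (B * C)"
    by (cases A; cases B; cases C) (simp add: times_mat2_def algebra_simps)
  show "(A + B) * C = A * C + B * C"
    by (cases A; cases B; cases C) (simp add: times_mat2_def algebra_simps)
  show "A * (B + C) = A * B + A * C"
    by (cases A; cases B; cases C) (simp add: times_mat2_def algebra_simps)
  show "A + B + C = A + (B + C)"
    by (cases A; cases B; cases C) (simp add: algebra_simps)
  show "A + B = B + A" "A - B = A + - B"
    by (cases A; cases B; simp)+
  show "0 + A = A" "- A + A = 0"
    by (cases A; simp add: zero_mat2_def)+
  show "1 * A = A" "A * 1 = A"
    by (cases A; simp add: one_mat2_def times_mat2_def mone_def)+
  show "(0 :: 'a mat2) \<noteq> 1"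
    by (simp add: zero_mat2_def one_mat2_def mone_def)
qed

end

lemma times_mat2 [simp]:
  "M2 a b c d * M2 a' b' c' d' =
    M2 (a * a' + b * c') (a * b' + b * d') (c * a' + d * c') (c * b' + d * d')"
  by (simp add: times_mat2_def)

lemma one_mat2: "1 = M2 1 0 0 1"
  by (simp add: one_mat2_def mone_def)

fun entries_in :: "'a set \<Rightarrow> 'a mat2 \<Rightarrow> bool" where
  "entries_in J (M2 a b c d) \<longleftrightarrow> a \<in> J \<and> b \<in> J \<and> c \<in> J \<and> d \<in> J"

lemma entries_in_ideal:
  assumes "is_ideal J"
  shows "entries_in J 0"
    "entries_in J A \<Longrightarrow> entries_in J B \<Longrightarrow> entries_in J (A + B)"
    "entries_in J A \<Longrightarrow> entries_in J B \<Longrightarrow> entries_in J (A - B)"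
    "entries_in J A \<Longrightarrow> entries_in J (- A)"
    "entries_in J A \<Longrightarrow> entries_in J (A * B)"
    "entries_in J B \<Longrightarrow> entries_in J (A * B)"
  by (cases A; cases B; simp add: zero_mat2_def is_idealD[OF assms])+

lemma entries_in_mono: "entries_in J A \<Longrightarrow> J \<subseteq> K \<Longrightarrow> entries_in K A"
  by (cases A) auto

lemma entries_in_mult:
  assumes "\<And>a b. a \<in> J \<Longrightarrow> b \<in> K \<Longrightarrow> a * b \<in> L" "is_ideal L" "entries_in J A" "entries_in K B"
  shows "entries_in L (A * B)"
  using assms(3,4) by (cases A; cases B) (simp add: assms(1) is_idealD(2)[OF assms(2)])

text \<open>The kernel of the reduction from R[t,t^-1] to S[t,t^-1].\<close>

definition Jcoeffs :: "nat \<Rightarrow> Rt set" where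
  "Jcoeffs q = {f. \<forall>n. Poly_Mapping.lookup f n \<in> Jq q}"

lemma is_ideal_Jcoeffs: "is_ideal (Jcoeffs q)"
  unfolding Jcoeffs_def Jq_def by (intro is_ideal_coefficients is_ideal_ideal_gen)

lemma mcong_iff: "mcong q A B \<longleftrightarrow> entries_in (Jcoeffs q) (A - B)"
  by (cases A; cases B) (simp add: congS_def Jcoeffs_def lookup_minus)

lemmas Jcoeffs_entries = entries_in_ideal[OF is_ideal_Jcoeffs]

section \<open>The group structure of \<open>FS q\<close>\<close>

lemma mcong_refl: "mcong q A A"
  by (simp add: mcong_iff Jcoeffs_entries)

lemma mcong_sym: "mcong q A B \<Longrightarrow> mcong q B A"
  using Jcoeffs_entries(4)[of q "A - B"] by (simp add: mcong_iff)

lemma mcong_trans: "mcong q A B \<Longrightarrow> mcong q B C \<Longrightarrow> mcong q A C"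
  using Jcoeffs_entries(2)[of q "A - B" "B - C"] by (simp add: mcong_iff)

lemma mcong_mult:
  assumes "mcong q A A'" "mcong q B B'"
  shows "mcong q (A * B) (A' * B')"
proof -
  have "A * B - A' * B' = (A - A') * B + A' * (B - B')"
    by (simp add: algebra_simps)
  then show ?thesis
    using assms by (simp add: mcong_iff Jcoeffs_entries)
qed

lemma mcls_eq_iff: "mcls q A = mcls q B \<longleftrightarrow> mcong q A B"
  unfolding mcls_def using mcong_refl mcong_sym mcong_trans by blast

text \<open>Congruence is compatible with products, so the representatives picked by
  \<open>SOME\<close> do not affect the class.\<close>

lemma FS_mult: "mcls q A \<otimes>\<^bsub>FS q\<^esub> mcls q B = mcls q (A * B)"
proof -
  have "mcong q A (SOME B. B \<in> mcls q A)" for A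
    using someI[of "\<lambda>B. B \<in> mcls q A" A] by (simp add: mcls_def mcong_refl)
  then have "mcong q (A * B) ((SOME A'. A' \<in> mcls q A) * (SOME B'. B' \<in> mcls q B))"
    by (intro mcong_mult)
  then show ?thesis
    by (simp add: FS_def mcls_eq_iff mcong_sym flip: times_mat2_def)
qed

lemma FS_one: "\<one>\<^bsub>FS q\<^esub> = mcls q 1"
  by (simp add: FS_def one_mat2_def)

lemma FS_carrier: "carrier (FS q) = mcls q ` Gen"
  by (simp add: FS_def)

lemma Gen_one: "1 \<in> Gen"
  by (simp add: one_mat2_def Gen.one)

lemma Gen_mult: "A \<in> Gen \<Longrightarrow> B \<in> Gen \<Longrightarrow> A * B \<in> Gen"
  by (simp add: times_mat2_def Gen.mul)

lemma cR_1 [simp]: "cR 1 = 1" and cR_0 [simp]: "cR 0 = 0"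
  by (simp_all add: cR_def)

lemma cR_diff: "cR (a - b) = cR a - cR b"
  by (simp add: cR_def single_diff)

lemma cR_mult: "cR (a * b) = cR a * cR b"
  by (simp add: cR_def mult_single)

lemma cR_power: "cR (a ^ n) = cR a ^ n"
  by (induction n) (simp_all add: cR_mult)

text \<open>\<open>Gen\<close> admits an inverse only once one is exhibited. The generators are
  triangular with the units 1, x and 1, yt on the diagonal, so explicit inverses can be written
  down.\<close>

lemma Gen_invertible: "A \<in> Gen \<Longrightarrow> \<exists>B\<in>Gen. A * B = 1 \<and> B * A = 1"
proof (induction rule: Gen.induct)
  case g1
  define x y x' where "x = cR xR" and "y = cR yR" and "x' = cR (mono (-1) 0)"
  have x: "x * x' = 1" "x' * x = 1"
    unfolding x_def x'_def by (simp_all add: xR_def mono_mult mono_0_0 flip: cR_mult)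
  define B where "B = M2 1 (- (1 - y) * x') 0 x'"
  have M1: "M1 = M2 1 (1 - y) 0 x"
    by (simp add: M1_def x_def y_def cR_diff)
  have B: "M1 * B = 1" "B * M1 = 1"
    unfolding M1 B_def times_mat2 one_mat2 by (simp_all add: x mult.assoc flip: distrib_right)
  then have "B \<in> Gen"
    using Gen.inv[OF Gen.g1] by (simp add: times_mat2_def one_mat2_def)
  with B show ?case by blast
next
  case g2
  define x u u' where "x = cR xR" and "u = cR yR * tT"
    and "u' = cR (mono 0 (-1)) * Poly_Mapping.single (-1) 1"
  have "cR yR * cR (mono 0 (-1)) = 1"
    by (simp add: yR_def mono_mult mono_0_0 flip: cR_mult)
  moreover have "tT * Poly_Mapping.single (-1) 1 = 1"
    by (simp add: tT_def mult_single)
  moreover have "u * u' = (cR yR * cR (mono 0 (-1))) * (tT * Poly_Mapping.single (-1) 1)"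
    by (simp only: u_def u'_def mult_ac)
  ultimately have u: "u * u' = 1"
    by simp
  define B where "B = M2 u' 0 (- (1 - x * tT) * u') 1"
  have M2T: "M2T = M2 u 0 (1 - x * tT) 1"
    by (simp add: M2T_def x_def u_def)
  have B: "M2T * B = 1" "B * M2T = 1"
    unfolding M2T B_def times_mat2 one_mat2 using u by (simp_all add: mult.assoc mult.commute[of u'] flip: distrib_right)
  then have "B \<in> Gen"
    using Gen.inv[OF Gen.g2] by (simp add: times_mat2_def one_mat2_def)
  with B show ?case by blast
next
  case one
  show ?case
    using Gen_one by (auto simp flip: one_mat2_def)
next
  case (mul A B)
  then obtain A' B' where *: "A' \<in> Gen" "A * A' = 1" "A' * A = 1" "B' \<in> Gen" "B * B' = 1" "B' * B = 1"
    by blast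
  have "(A * B) * (B' * A') = A * (B * B') * A'" "(B' * A') * (A * B) = B' * (A' * A) * B"
    by (simp_all only: mult.assoc)
  then show ?case
    using * Gen_mult[of B' A'] by (auto simp flip: times_mat2_def)
next
  case (inv A B)
  then show ?case
    by (auto simp: times_mat2_def one_mat2_def)
qed

lemma FS_group: "group (FS q)"
proof (rule groupI)
  fix X assume "X \<in> carrier (FS q)"
  then obtain A where A: "A \<in> Gen" "X = mcls q A"
    by (auto simp: FS_carrier)
  then obtain B where "B \<in> Gen" "B * A = 1"
    using Gen_invertible by blast
  then show "\<exists>Y\<in>carrier (FS q). Y \<otimes>\<^bsub>FS q\<^esub> X = \<one>\<^bsub>FS q\<^esub>"
    using A(2) by (intro bexI[of _ "mcls q B"]) (auto simp: FS_mult FS_one FS_carrier)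
qed (auto simp: FS_carrier FS_mult FS_one Gen_one Gen_mult mult.assoc)

lemma FS_inv:
  assumes "A \<in> Gen" "B \<in> Gen" "A * B = 1" "B * A = 1"
  shows "inv\<^bsub>FS q\<^esub> (mcls q A) = mcls q B"
  using assms by (intro group.inv_equality[OF FS_group]) (auto simp: FS_mult FS_one FS_carrier)

section \<open>Congruence subgroups and the derived series\<close>

text \<open>The extension of \<Sigma>^n to R[t,t^-1], as x - 1 and y - 1 generate \<Sigma>. With
  monomial generators, containments need only be checked on
  \<open>(xR - 1) ^ i * (yR - 1) ^ j\<close>.\<close>

definition Sigma_power :: "nat \<Rightarrow> Rt set" where
  "Sigma_power n = ideal_gen {(cR xR - 1) ^ i * (cR yR - 1) ^ j | i j. i + j = n}"

lemma is_ideal_Sigma_power: "is_ideal (Sigma_power n)"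
  unfolding Sigma_power_def by (rule is_ideal_ideal_gen)

lemma Sigma_power_generator:
  "i + j = n \<Longrightarrow> (cR xR - 1) ^ i * (cR yR - 1) ^ j \<in> Sigma_power n"
  unfolding Sigma_power_def by (intro ideal_gen_base) blast

lemma Sigma_power_1: "cR xR - 1 \<in> Sigma_power 1" "cR yR - 1 \<in> Sigma_power 1"
  using Sigma_power_generator[of 1 0 1] Sigma_power_generator[of 0 1 1] by simp_all

lemma Sigma_power_mult:
  assumes "a \<in> Sigma_power m" "b \<in> Sigma_power n"
  shows "a * b \<in> Sigma_power (m + n)"
proof -
  note ideal = is_idealD[OF is_ideal_Sigma_power]
  have generator: "(cR xR - 1) ^ i * (cR yR - 1) ^ j * b \<in> Sigma_power (m + n)" if "i + j = m" for i j
    using assms(2) unfolding Sigma_power_def[of n]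
  proof induction
    case (gen h r)
    then obtain k l where h: "h = (cR xR - 1) ^ k * (cR yR - 1) ^ l" "k + l = n"
      by blast
    have "(cR xR - 1) ^ i * (cR yR - 1) ^ j * (r * h) =
        r * ((cR xR - 1) ^ (i + k) * (cR yR - 1) ^ (j + l))"
      by (simp only: h(1) power_add mult_ac)
    also have "\<dots> \<in> Sigma_power (m + n)"
      using that h(2) by (intro ideal(3) Sigma_power_generator) simp
    finally show ?case .
  qed (auto simp: distrib_left intro: ideal(1,2))
  show ?thesis
    using assms(1) unfolding Sigma_power_def[of m]
  proof induction
    case (gen g r)
    then obtain i j where "g = (cR xR - 1) ^ i * (cR yR - 1) ^ j" "i + j = m"
      by blast
    then have "g * b \<in> Sigma_power (m + n)"
      using generator by simp
    then show ?case
      unfolding mult.assoc by (rule ideal(3))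
  qed (auto simp: distrib_right intro: ideal(1,2))
qed

text \<open>The group \<Gamma>(n), taken before reduction to S; its image under
  \<open>mcls q\<close> is the subgroup used below.\<close>

definition congruence_kernel :: "nat \<Rightarrow> Rt mat2 set" where
  "congruence_kernel n = {A \<in> Gen. entries_in (Sigma_power n) (A - 1)}"

lemma one_in_congruence_kernel: "1 \<in> congruence_kernel n"
  by (simp add: congruence_kernel_def Gen_one entries_in_ideal is_ideal_Sigma_power)

lemma congruence_kernel_subgroup: "subgroup (mcls q ` congruence_kernel n) (FS q)"
proof (rule group.subgroupI[OF FS_group])
  note ideal = entries_in_ideal[OF is_ideal_Sigma_power]
  show "mcls q ` congruence_kernel n \<subseteq> carrier (FS q)"
    by (auto simp: FS_carrier congruence_kernel_def)
  show "mcls q ` congruence_kernel n \<noteq> {}"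
    using one_in_congruence_kernel by auto
  fix X assume "X \<in> mcls q ` congruence_kernel n"
  then obtain A where A: "A \<in> Gen" "entries_in (Sigma_power n) (A - 1)" "X = mcls q A"
    by (auto simp: congruence_kernel_def)
  obtain B where B: "B \<in> Gen" "A * B = 1" "B * A = 1"
    using Gen_invertible A(1) by blast
  have "B - 1 = - (B * (A - 1))"
    using B by (simp add: algebra_simps)
  then have "B \<in> congruence_kernel n"
    using A B by (simp add: congruence_kernel_def ideal)
  then show "inv\<^bsub>FS q\<^esub> X \<in> mcls q ` congruence_kernel n"
    using FS_inv[OF A(1) B] A(3) by auto
  fix Y assume "Y \<in> mcls q ` congruence_kernel n"
  then obtain C where C: "C \<in> Gen" "entries_in (Sigma_power n) (C - 1)" "Y = mcls q C"
    by (auto simp: congruence_kernel_def)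
  have eq: "A * C - 1 = (A - 1) * C + (C - 1)"
    by (simp add: algebra_simps)
  have "entries_in (Sigma_power n) (A * C - 1)"
    unfolding eq by (rule ideal(2)[OF ideal(5)[OF A(2)] C(2)])
  then have "A * C \<in> congruence_kernel n"
    using A C by (simp add: congruence_kernel_def Gen_mult)
  then show "X \<otimes>\<^bsub>FS q\<^esub> Y \<in> mcls q ` congruence_kernel n"
    using A C by (auto simp: FS_mult)
qed

text \<open>The group commutator minus \<open>1\<close> is \<open>A * B - B * A\<close> times a
  matrix, so additive commutators decide. As the target is a subgroup, it suffices to treat the
  generating commutators.\<close>

lemma derived_subset_congruence_kernel:
  assumes "K \<subseteq> Gen"
    and comm: "\<And>A B. A \<in> K \<Longrightarrow> B \<in> K \<Longrightarrow> entries_in (Sigma_power n) (A * B - B * A)"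
  shows "derived (FS q) (mcls q ` K) \<subseteq> mcls q ` congruence_kernel n"
  unfolding derived_def
proof (rule group.generate_subgroup_incl[OF FS_group _ congruence_kernel_subgroup], rule subsetI)
  fix X assume "X \<in> derived_set (FS q) (mcls q ` K)"
  then obtain A B where AB: "A \<in> K" "B \<in> K" and X: "X = mcls q A \<otimes>\<^bsub>FS q\<^esub> mcls q B
      \<otimes>\<^bsub>FS q\<^esub> inv\<^bsub>FS q\<^esub> mcls q A \<otimes>\<^bsub>FS q\<^esub> inv\<^bsub>FS q\<^esub> mcls q B"
    by blast
  obtain A' where A': "A \<in> Gen" "A' \<in> Gen" "A * A' = 1" "A' * A = 1"
    using Gen_invertible[of A] assms(1) AB(1) by blast
  obtain B' where B': "B \<in> Gen" "B' \<in> Gen" "B * B' = 1" "B' * B = 1"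
    using Gen_invertible[of B] assms(1) AB(2) by blast
  have "B * A * (A' * B') = B * (A * A') * B'"
    by (simp only: mult.assoc)
  then have "A * B * A' * B' - 1 = (A * B - B * A) * (A' * B')"
    using A' B' by (simp add: left_diff_distrib mult.assoc)
  then have "A * B * A' * B' \<in> congruence_kernel n"
    using comm[OF AB] A' B' by (simp add: congruence_kernel_def Gen_mult entries_in_ideal is_ideal_Sigma_power)
  moreover have "X = mcls q (A * B * A' * B')"
    unfolding X FS_inv[OF A'] FS_inv[OF B'] FS_mult ..
  ultimately show "X \<in> mcls q ` congruence_kernel n"
    by simp
qed

text \<open>Subtracting \<open>1\<close> from both factors leaves the additive commutator unchanged,
  and levels add under products.\<close>

lemma congruence_kernel_commutator:
  assumes "A \<in> congruence_kernel m" "B \<in> congruence_kernel n"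
  shows "entries_in (Sigma_power (m + n)) (A * B - B * A)"
proof -
  have A: "entries_in (Sigma_power m) (A - 1)" and B: "entries_in (Sigma_power n) (B - 1)"
    using assms by (auto simp: congruence_kernel_def)
  have "A * B - B * A = (A - 1) * (B - 1) - (B - 1) * (A - 1)"
    by (simp add: algebra_simps)
  moreover have "entries_in (Sigma_power (m + n)) ((A - 1) * (B - 1))"
    by (rule entries_in_mult[OF _ is_ideal_Sigma_power A B]) (rule Sigma_power_mult)
  moreover have "entries_in (Sigma_power (m + n)) ((B - 1) * (A - 1))"
    unfolding add.commute[of m n]
    by (rule entries_in_mult[OF _ is_ideal_Sigma_power B A]) (rule Sigma_power_mult)
  ultimately show ?thesis
    by (simp add: entries_in_ideal is_ideal_Sigma_power)
qed

text \<open>Setting \<open>x = y = 1\<close> turns the two generators into \<open>1\<close> and a matrix of the following shape; matrices of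
  this shape multiply like the units \<open>\<tau>\<close>, whence the image is abelian.\<close>

lemma Gen_mod_Sigma:
  assumes "A \<in> Gen"
  shows "\<exists>\<tau> \<tau>'. \<tau> * \<tau>' = 1 \<and> entries_in (Sigma_power 1) (A - M2 \<tau> 0 (1 - \<tau>) 1)"
  using assms
proof induction
  note ideal = is_idealD[OF is_ideal_Sigma_power]
  case g1
  have "M1 - M2 1 0 (1 - 1) 1 = M2 0 (- (cR yR - 1)) 0 (cR xR - 1)"
    by (simp add: M1_def cR_diff)
  then show ?case
    using Sigma_power_1 by (intro exI[of _ 1]) (simp add: ideal del: minus_diff_eq)
next
  note ideal = is_idealD[OF is_ideal_Sigma_power]
  case g2
  have "M2T - M2 tT 0 (1 - tT) 1 = M2 ((cR yR - 1) * tT) 0 (- ((cR xR - 1) * tT)) 0"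
    by (simp add: M2T_def algebra_simps)
  moreover have "tT * Poly_Mapping.single (-1) 1 = 1"
    by (simp add: tT_def mult_single)
  ultimately show ?case
    using Sigma_power_1 by (intro exI[of _ tT] exI[of _ "Poly_Mapping.single (-1) 1"]) (simp add: ideal)
next
  case one
  have "mone - M2 1 0 (1 - 1) 1 = (0 :: Rt mat2)"
    by (simp add: mone_def zero_mat2_def)
  then show ?case
    by (intro exI[of _ 1]) (simp add: entries_in_ideal is_ideal_Sigma_power)
next
  note ideal = entries_in_ideal[OF is_ideal_Sigma_power]
  case (mul A B)
  then obtain \<tau> \<tau>' \<sigma> \<sigma>' where *: "\<tau> * \<tau>' = 1" "entries_in (Sigma_power 1) (A - M2 \<tau> 0 (1 - \<tau>) 1)"
    "\<sigma> * \<sigma>' = 1" "entries_in (Sigma_power 1) (B - M2 \<sigma> 0 (1 - \<sigma>) 1)"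
    by blast
  have "M2 (\<tau> * \<sigma>) 0 (1 - \<tau> * \<sigma>) 1 = M2 \<tau> 0 (1 - \<tau>) 1 * M2 \<sigma> 0 (1 - \<sigma>) 1"
    by (simp add: algebra_simps)
  then have "A * B - M2 (\<tau> * \<sigma>) 0 (1 - \<tau> * \<sigma>) 1 =
      (A - M2 \<tau> 0 (1 - \<tau>) 1) * B + M2 \<tau> 0 (1 - \<tau>) 1 * (B - M2 \<sigma> 0 (1 - \<sigma>) 1)"
    by (simp only: left_diff_distrib right_diff_distrib) simp
  moreover have "(\<tau> * \<sigma>) * (\<tau>' * \<sigma>') = (\<tau> * \<tau>') * (\<sigma> * \<sigma>')"
    by (simp only: mult_ac)
  ultimately show ?case
    using * by (intro exI[of _ "\<tau> * \<sigma>"] exI[of _ "\<tau>' * \<sigma>'"]) (simp add: ideal flip: times_mat2_def)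
next
  note ideal = entries_in_ideal[OF is_ideal_Sigma_power]
  case (inv A B)
  then obtain \<tau> \<tau>' where *: "\<tau> * \<tau>' = 1" "entries_in (Sigma_power 1) (A - M2 \<tau> 0 (1 - \<tau>) 1)"
    by blast
  have "B * A = 1"
    using inv by (simp add: times_mat2_def one_mat2_def)
  \<comment> \<open>The unit inverse \<open>\<tau>'\<close> is carried through the induction for
    this case: it provides the inverse of the approximating matrix.\<close>
  moreover have "M2 \<tau> 0 (1 - \<tau>) 1 * M2 \<tau>' 0 (1 - \<tau>') 1 = 1"
    using *(1) by (simp add: one_mat2 algebra_simps)
  ultimately have "B - M2 \<tau>' 0 (1 - \<tau>') 1 = - (B * (A - M2 \<tau> 0 (1 - \<tau>) 1) * M2 \<tau>' 0 (1 - \<tau>') 1)"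
    by (simp only: left_diff_distrib right_diff_distrib mult.assoc) (simp flip: mult.assoc)
  then show ?case
    using * by (intro exI[of _ \<tau>'] exI[of _ \<tau>]) (simp add: ideal mult.commute)
qed

text \<open>Modulo \<Sigma> the two matrices may be replaced by \<open>C\<close> and
  \<open>D\<close>, which commute.\<close>

lemma Gen_commutator:
  assumes "A \<in> Gen" "B \<in> Gen"
  shows "entries_in (Sigma_power 1) (A * B - B * A)"
proof -
  note ideal = entries_in_ideal[OF is_ideal_Sigma_power]
  obtain \<tau> \<sigma> where *: "entries_in (Sigma_power 1) (A - M2 \<tau> 0 (1 - \<tau>) 1)"
      "entries_in (Sigma_power 1) (B - M2 \<sigma> 0 (1 - \<sigma>) 1)"
    using Gen_mod_Sigma assms by blast
  define C D where "C = M2 \<tau> 0 (1 - \<tau>) 1" and "D = M2 \<sigma> 0 (1 - \<sigma>) 1"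
  have "C * D = D * C"
    by (simp add: C_def D_def algebra_simps)
  then have "A * B - B * A = (A - C) * B + C * (B - D) - ((B - D) * A + D * (A - C))"
    by (simp add: algebra_simps)
  then show ?thesis
    using * by (simp add: ideal C_def D_def)
qed

text \<open>The first derived subgroup reaches level \<open>1\<close> because the group is abelian
  modulo \<Sigma>; every later one doubles the level. This is the shift between \<open>Suc k\<close>
  and \<open>2 ^ k\<close>.\<close>

lemma derived_power_subset_congruence_kernel:
  "(derived (FS q) ^^ Suc k) (carrier (FS q)) \<subseteq> mcls q ` congruence_kernel (2 ^ k)"
proof (induction k)
  case 0
  show ?case
    using derived_subset_congruence_kernel[OF order_refl Gen_commutator] by (simp add: FS_carrier)
next
  case (Suc k)
  have "derived (FS q) (mcls q ` congruence_kernel (2 ^ k)) \<subseteq> mcls q ` congruence_kernel (2 ^ k + 2 ^ k)"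
    by (rule derived_subset_congruence_kernel[OF _ congruence_kernel_commutator]) (auto simp: congruence_kernel_def)
  then show ?case
    using group.mono_derived[OF FS_group[of q] Suc] by (simp add: mult_2)
qed

lemma congruence_kernel_trivial:
  assumes "Sigma_power n \<subseteq> Jcoeffs q"
  shows "mcls q ` congruence_kernel n \<subseteq> {\<one>\<^bsub>FS q\<^esub>}"
proof
  fix X assume "X \<in> mcls q ` congruence_kernel n"
  then obtain A where A: "X = mcls q A" "entries_in (Sigma_power n) (A - 1)"
    by (auto simp: congruence_kernel_def)
  then have "mcong q A 1"
    using entries_in_mono[OF _ assms] by (simp add: mcong_iff)
  then show "X \<in> {\<one>\<^bsub>FS q\<^esub>}"
    by (simp add: A(1) FS_one mcls_eq_iff)
qed

text \<open>From a generator of degree above \<open>N\<close> one factor in \<Sigma> is split off;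
  the rest still has degree at least \<open>N\<close> and lies in I(q).\<close>

lemma Sigma_power_subset_Jcoeffs:
  assumes Iq: "\<And>i j. i + j = N \<Longrightarrow> (xR - 1) ^ i * (yR - 1) ^ j \<in> Iq q" and n: "n \<ge> Suc N"
  shows "Sigma_power n \<subseteq> Jcoeffs q"
proof -
  have Iq': "(xR - 1) ^ i * (yR - 1) ^ j \<in> Iq q" if "i + j \<ge> N" for i j
  proof -
    \<comment> \<open>These exponents cut out a divisor of degree exactly \<open>N\<close>.\<close>
    define i' j' where "i' = min i N" and "j' = N - i'"
    have *: "i' + j' = N" "i = i' + (i - i')" "j = j' + (j - j')"
      using that by (auto simp: i'_def j'_def)
    have "(xR - 1) ^ i * (yR - 1) ^ j =
        (xR - 1) ^ (i' + (i - i')) * (yR - 1) ^ (j' + (j - j'))"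
      by (simp only: *(2,3)[symmetric])
    also have "\<dots> = (xR - 1) ^ (i - i') * (yR - 1) ^ (j - j') * ((xR - 1) ^ i' * (yR - 1) ^ j')"
      by (simp only: power_add mult_ac)
    also have "\<dots> \<in> Iq q"
      by (intro Iq_mult Iq *(1))
    finally show ?thesis .
  qed
  have Sigma: "xR - 1 \<in> Sigma_ideal" "yR - 1 \<in> Sigma_ideal"
  proof -
    \<comment> \<open>The augmentation is evaluation at \<open>(1, 1)\<close>.\<close>
    have "augmentation f = 0" if "ev 1 1 f = 0" for f
    proof -
      have "(of_int (augmentation f) :: complex) = ev 1 1 f"
        by (simp add: augmentation_def ev_def)
      with that show ?thesis by simp
    qed
    then show "xR - 1 \<in> Sigma_ideal" "yR - 1 \<in> Sigma_ideal"
      by (simp_all add: Sigma_ideal_def)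
  qed
  have Jq: "(xR - 1) ^ i * (yR - 1) ^ j \<in> Jq q" if ij: "i + j = n" for i j
  proof -
    have prod: "a * b \<in> Jq q" if "a \<in> Iq q" "b \<in> Sigma_ideal" for a b
      unfolding Jq_def using that by (intro ideal_gen_base) blast
    show ?thesis
    proof (cases i)
      case (Suc i')
      then have "(xR - 1) ^ i * (yR - 1) ^ j = ((xR - 1) ^ i' * (yR - 1) ^ j) * (xR - 1)"
        by (simp add: mult_ac)
      also have "\<dots> \<in> Jq q"
        using ij n Suc by (intro prod Iq' Sigma) simp
      finally show ?thesis .
    next
      case 0
      then obtain j' where j': "j = Suc j'"
        using ij n by (cases j) auto
      then have "(xR - 1) ^ i * (yR - 1) ^ j = ((xR - 1) ^ i * (yR - 1) ^ j') * (yR - 1)"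
        by (simp add: mult_ac)
      also have "\<dots> \<in> Jq q"
        using ij n j' by (intro prod Iq' Sigma) simp
      finally show ?thesis .
    qed
  qed
  show ?thesis
  proof
    fix f assume "f \<in> Sigma_power n"
    then show "f \<in> Jcoeffs q"
      unfolding Sigma_power_def
    proof induction
      case (gen g r)
      then obtain i j where g: "g = (cR xR - 1) ^ i * (cR yR - 1) ^ j" "i + j = n"
        by blast
      then have "g = cR ((xR - 1) ^ i * (yR - 1) ^ j)"
        by (simp add: cR_mult cR_power cR_diff)
      moreover have "0 \<in> Jq q"
        by (simp add: Jq_def ideal_gen.zero)
      ultimately have "g \<in> Jcoeffs q"
        using Jq[OF g(2)] by (simp add: Jcoeffs_def cR_def lookup_single when_def)
      then show ?case
        by (rule is_idealD(3)[OF is_ideal_Jcoeffs])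
    qed (auto intro: is_idealD[OF is_ideal_Jcoeffs])
  qed
qed

theorem theorem1:
  fixes p e :: nat
  assumes "prime p" and "e \<ge> 1"
  shows "solvable (FS (p ^ e)) \<and>
         (\<forall>k::nat. k \<ge> 1 \<longrightarrow> 2 ^ (k - 1) \<ge> e * (p ^ e - p ^ (e - 1)) + 1 \<longrightarrow>
             (derived (FS (p ^ e)) ^^ k) (carrier (FS (p ^ e))) = {\<one>\<^bsub>FS (p ^ e)\<^esub>})"
proof -
  define N where "N = e * (p ^ e - p ^ (e - 1))"
  interpret group "FS (p ^ e)"
    by (rule FS_group)
  have trivial: "(derived (FS (p ^ e)) ^^ k) (carrier (FS (p ^ e))) = {\<one>\<^bsub>FS (p ^ e)\<^esub>}"
    if k: "k \<ge> 1" "2 ^ (k - 1) \<ge> N + 1" for k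
  proof
    have "(derived (FS (p ^ e)) ^^ Suc (k - 1)) (carrier (FS (p ^ e))) \<subseteq> mcls (p ^ e) ` congruence_kernel (2 ^ (k - 1))"
      by (rule derived_power_subset_congruence_kernel)
    also have "\<dots> \<subseteq> {\<one>\<^bsub>FS (p ^ e)\<^esub>}"
      using k(2) augmentation_power_in_Iq[OF assms] unfolding N_def[symmetric]
      by (intro congruence_kernel_trivial Sigma_power_subset_Jcoeffs[of N]) auto
    finally show "(derived (FS (p ^ e)) ^^ k) (carrier (FS (p ^ e))) \<subseteq> {\<one>\<^bsub>FS (p ^ e)\<^esub>}"
      using k(1) by simp
    show "{\<one>\<^bsub>FS (p ^ e)\<^esub>} \<subseteq> (derived (FS (p ^ e)) ^^ k) (carrier (FS (p ^ e)))"
      using subgroup.one_closed[OF exp_of_derived_is_subgroup[OF subgroup_self]] by blast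
  qed
  \<comment> \<open>So \<open>k = N + 2\<close> satisfies the bound, which yields
    solvability.\<close>
  have "N + 1 \<le> 2 ^ (N + 1)"
    by (rule less_imp_le[OF less_exp])
  then have "(derived (FS (p ^ e)) ^^ (N + 2)) (carrier (FS (p ^ e))) = {\<one>\<^bsub>FS (p ^ e)\<^esub>}"
    by (intro trivial) simp_all
  then have "solvable (FS (p ^ e))"
    unfolding solvable_iff_trivial_derived_seq by blast
  then show ?thesis
    using trivial unfolding N_def by blast
qed

end
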